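(* Let $X$ be a smooth vector field on a smooth manifold $M$ admitting an invariant volume form $\Omega$ and a vector field $Z$ satisfying $[X,Z]=\lambda X$ for some $\lambda\in C^\infty(M)$. Then the function $h:=\operatorname{div}_\Omega(Z)-\lambda$ is a first integral of $X$. Moreover, if $\mathrm{L}_Zh$ is non-zero (at every point) on $\operatorname{supp}(X)$, then $X$ is Hamiltonian on $M$ with respect to the Poisson structure of rank at most two defined by $$\pi:=\begin{cases}\dfrac{1}{\mathrm{L}_Zh}\,Z\wedge X&\text{on }\operatorname{supp}(X),\\0&\text{elsewhere}.\end{cases}$$
   Context: $\Omega$ is invariant if $\mathrm{L}_X\Omega=0$; $\operatorname{div}_\Omega(Z)$ is defined by $\mathrm{L}_Z\Omega=\operatorname{div}_\Omega(Z)\,\Omega$. A first integral of $X$ is a function $h$ with $\mathrm{d}h(X)=0$. $\operatorname{supp}(X)$ is the closure of $\{X\neq0\}$. A Poisson structure is a bivector field $\pi$ with $[\pi,\pi]=0$ (Schouten–Nijenhuis bracket); $\pi^\sharp\alpha=\mathbf{i}_\alpha\pi=\pi(\alpha,\cdot)$, the rank at $x$ is $\dim\pi^\sharp(T_x^*M)$, and $X$ is Hamiltonian on $M$ with respect to $\pi$ if $X=\pi^\sharp\mathrm{d}f$ for some $f\in C^\infty(M)$. *)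

theory Defs
  imports
    "HOL-Analysis.Analysis"
    "HOL-Combinatorics.Permutations"
    "HOL-Library.Function_Algebras"
begin

section \<open>Spaces of functions as real vector spaces\<close>

instantiation "fun" :: (type, scaleR) scaleR
begin
definition scaleR_fun :: "real \<Rightarrow> ('a \<Rightarrow> 'b) \<Rightarrow> 'a \<Rightarrow> 'b"
  where "scaleR_fun c f = (\<lambda>x. c *\<^sub>R f x)"
instance ..
end

instance "fun" :: (type, real_vector) real_vector
  by standard
    (simp_all add: scaleR_fun_def fun_eq_iff plus_fun_def scaleR_right_distrib scaleR_left_distrib)


section \<open>Smooth maps between normed spaces\<close>

text \<open>Only used for (relatively) open sets, see \<open>smooth_manifold\<close>.\<close>

fun Ck_on :: "nat \<Rightarrow> 'a::real_normed_vector set \<Rightarrow> ('a \<Rightarrow> 'b::real_normed_vector) \<Rightarrow> bool" where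
  "Ck_on 0 S f \<longleftrightarrow> continuous_on S f"
| "Ck_on (Suc k) S f \<longleftrightarrow> f differentiable_on S \<and>
     (\<forall>v. Ck_on k S (\<lambda>x. frechet_derivative f (at x within S) v))"

definition smooth_on :: "'a::real_normed_vector set \<Rightarrow> ('a \<Rightarrow> 'b::real_normed_vector) \<Rightarrow> bool"
  where "smooth_on S f \<longleftrightarrow> (\<forall>k. Ck_on k S f)"


section \<open>Smooth manifolds\<close>

text \<open>A chart is a domain together with a coordinate map. The manifold is the whole type
  \<^typ>\<open>'m\<close>; being Hausdorff and second countable are sort constraints on \<^typ>\<open>'m\<close>.\<close>

type_synonym ('m, 'e) chart = "'m set \<times> ('m \<Rightarrow> 'e)"

text \<open>Coordinates in dimension \<open>n > 0\<close> live in a Euclidean space \<^typ>\<open>'e\<close> with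
  \<open>DIM('e) = n\<close>. No such type has dimension zero, so the zero-dimensional model space is a
  single point of \<^typ>\<open>'e\<close>; every map on it is \<^const>\<open>smooth_on\<close>.\<close>

definition model_space :: "nat \<Rightarrow> 'e::euclidean_space set"
  where "model_space n = (if n = 0 then {0} else UNIV)"

definition smooth_manifold ::
    "nat \<Rightarrow> ('m::{t2_space,second_countable_topology}, 'e::euclidean_space) chart set \<Rightarrow> bool"
  where "smooth_manifold n A \<longleftrightarrow>
    (n = 0 \<or> n = DIM('e)) \<and>
    (\<forall>(U, \<phi>) \<in> A. open U \<and> openin (top_of_set (model_space n)) (\<phi> ` U) \<and>
        homeomorphism U (\<phi> ` U) \<phi> (inv_into U \<phi>)) \<and>
    (\<Union>(U, \<phi>) \<in> A. U) = UNIV \<and>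
    (\<forall>(U, \<phi>) \<in> A. \<forall>(V, \<psi>) \<in> A. smooth_on (\<phi> ` (U \<inter> V)) (\<psi> \<circ> inv_into U \<phi>))"

definition smooth_functions ::
    "('m::{t2_space,second_countable_topology}, 'e::euclidean_space) chart set \<Rightarrow> ('m \<Rightarrow> real) set"
  where "smooth_functions A = {f. \<forall>(U, \<phi>) \<in> A. smooth_on (\<phi> ` U) (f \<circ> inv_into U \<phi>)}"


section \<open>Tangent and cotangent spaces, vector fields\<close>

text \<open>Tangent vectors at \<open>p\<close> are the derivations at \<open>p\<close> of the algebra of smooth functions.
  Tangent vectors and covectors are extended by zero outside their domain, so that equality of
  HOL functions is equality of tangent vectors and of covectors.\<close>

type_synonym 'm tvec = "('m \<Rightarrow> real) \<Rightarrow> real"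
type_synonym 'm covec = "'m tvec \<Rightarrow> real"

definition tangent_space ::
    "('m::{t2_space,second_countable_topology}, 'e::euclidean_space) chart set \<Rightarrow> 'm \<Rightarrow> 'm tvec set"
  where "tangent_space A p = {v.
    (\<forall>f\<in>smooth_functions A. \<forall>g\<in>smooth_functions A.
        v (f + g) = v f + v g \<and> v (f * g) = f p * v g + g p * v f) \<and>
    (\<forall>c. \<forall>f\<in>smooth_functions A. v (c *\<^sub>R f) = c * v f) \<and>
    (\<forall>f. f \<notin> smooth_functions A \<longrightarrow> v f = 0)}"

definition cotangent_space ::
    "('m::{t2_space,second_countable_topology}, 'e::euclidean_space) chart set \<Rightarrow> 'm \<Rightarrow> 'm covec set"
  where "cotangent_space A p = {\<alpha>.
    (\<forall>v\<in>tangent_space A p. \<forall>w\<in>tangent_space A p. \<alpha> (v + w) = \<alpha> v + \<alpha> w) \<and>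
    (\<forall>c. \<forall>v\<in>tangent_space A p. \<alpha> (c *\<^sub>R v) = c * \<alpha> v) \<and>
    (\<forall>v. v \<notin> tangent_space A p \<longrightarrow> \<alpha> v = 0)}"

definition differential ::
    "('m::{t2_space,second_countable_topology}, 'e::euclidean_space) chart set
      \<Rightarrow> ('m \<Rightarrow> real) \<Rightarrow> 'm \<Rightarrow> 'm covec"
  where "differential A f p = (\<lambda>v. if v \<in> tangent_space A p then v f else 0)"

type_synonym 'm vfield = "'m \<Rightarrow> 'm tvec"

definition vector_fields ::
    "('m::{t2_space,second_countable_topology}, 'e::euclidean_space) chart set \<Rightarrow> 'm vfield set"
  where "vector_fields A = {X.
    (\<forall>p. X p \<in> tangent_space A p) \<and>
    (\<forall>f\<in>smooth_functions A. (\<lambda>p. X p f) \<in> smooth_functions A)}"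

definition vf_support :: "'m::topological_space vfield \<Rightarrow> 'm set"
  where "vf_support X = closure {p. X p \<noteq> 0}"

definition lie_bracket :: "'m vfield \<Rightarrow> 'm vfield \<Rightarrow> 'm vfield"
  where "lie_bracket X Y = (\<lambda>p f. X p (\<lambda>q. Y q f) - Y p (\<lambda>q. X q f))"

definition lie_derivative_fun :: "'m vfield \<Rightarrow> ('m \<Rightarrow> real) \<Rightarrow> 'm \<Rightarrow> real"
  where "lie_derivative_fun X f = (\<lambda>p. X p f)"

definition first_integral ::
    "('m::{t2_space,second_countable_topology}, 'e::euclidean_space) chart set
      \<Rightarrow> 'm vfield \<Rightarrow> ('m \<Rightarrow> real) \<Rightarrow> bool"
  where "first_integral A X h \<longleftrightarrow>
    h \<in> smooth_functions A \<and> (\<forall>p. differential A h p (X p) = 0)"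


section \<open>Differential forms and the divergence\<close>

definition alternating_multilinear :: "'v::real_vector set \<Rightarrow> nat \<Rightarrow> ('v list \<Rightarrow> real) \<Rightarrow> bool"
  where "alternating_multilinear V k \<omega> \<longleftrightarrow>
    (\<forall>vs\<in>lists V. length vs = k \<longrightarrow>
      (\<forall>i<k. \<forall>u\<in>V. \<forall>w\<in>V. \<forall>a b.
         \<omega> (vs[i := a *\<^sub>R u + b *\<^sub>R w]) = a * \<omega> (vs[i := u]) + b * \<omega> (vs[i := w])) \<and>
      (\<not> distinct vs \<longrightarrow> \<omega> vs = 0))"

type_synonym 'm form = "'m \<Rightarrow> 'm tvec list \<Rightarrow> real"

definition form_apply :: "'m form \<Rightarrow> 'm vfield list \<Rightarrow> 'm \<Rightarrow> real"
  where "form_apply \<omega> Ys = (\<lambda>p. \<omega> p (map (\<lambda>Y. Y p) Ys))"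

definition differential_form ::
    "('m::{t2_space,second_countable_topology}, 'e::euclidean_space) chart set
      \<Rightarrow> nat \<Rightarrow> 'm form \<Rightarrow> bool"
  where "differential_form A k \<omega> \<longleftrightarrow>
    (\<forall>p. alternating_multilinear (tangent_space A p) k (\<omega> p)) \<and>
    (\<forall>Ys\<in>lists (vector_fields A). length Ys = k \<longrightarrow> form_apply \<omega> Ys \<in> smooth_functions A)"

definition volume_form ::
    "nat \<Rightarrow> ('m::{t2_space,second_countable_topology}, 'e::euclidean_space) chart set
      \<Rightarrow> 'm form \<Rightarrow> bool"
  where "volume_form n A \<Omega> \<longleftrightarrow> differential_form A n \<Omega> \<and>
    (\<forall>p. \<exists>vs\<in>lists (tangent_space A p). length vs = n \<and> \<Omega> p vs \<noteq> 0)"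

text \<open>The Lie derivative of a \<open>k\<close>-form, evaluated on \<open>k\<close> vector fields:
  \<open>(L\<^sub>X \<omega>)(Y\<^sub>1,\<dots>,Y\<^sub>k) = X(\<omega>(Y\<^sub>1,\<dots>,Y\<^sub>k)) - \<Sum>\<^sub>i \<omega>(Y\<^sub>1,\<dots>,[X,Y\<^sub>i],\<dots>,Y\<^sub>k)\<close>.\<close>

definition lie_derivative_form :: "'m vfield \<Rightarrow> 'm form \<Rightarrow> 'm vfield list \<Rightarrow> 'm \<Rightarrow> real"
  where "lie_derivative_form X \<omega> Ys = (\<lambda>p. X p (form_apply \<omega> Ys) -
    (\<Sum>i<length Ys. form_apply \<omega> (Ys[i := lie_bracket X (Ys ! i)]) p))"

definition invariant_form ::
    "nat \<Rightarrow> ('m::{t2_space,second_countable_topology}, 'e::euclidean_space) chart set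
      \<Rightarrow> 'm vfield \<Rightarrow> 'm form \<Rightarrow> bool"
  where "invariant_form k A X \<omega> \<longleftrightarrow>
    (\<forall>Ys\<in>lists (vector_fields A). length Ys = k \<longrightarrow> lie_derivative_form X \<omega> Ys = 0)"

definition divergence ::
    "nat \<Rightarrow> ('m::{t2_space,second_countable_topology}, 'e::euclidean_space) chart set
      \<Rightarrow> 'm form \<Rightarrow> 'm vfield \<Rightarrow> 'm \<Rightarrow> real"
  where "divergence n A \<Omega> Z = (THE g. g \<in> smooth_functions A \<and>
    (\<forall>Ys\<in>lists (vector_fields A). length Ys = n \<longrightarrow>
       lie_derivative_form Z \<Omega> Ys = g * form_apply \<Omega> Ys))"


section \<open>Multivector fields and Poisson structures\<close>

text \<open>A \<open>k\<close>-vector at \<open>p\<close> is an alternating \<open>k\<close>-linear function on the cotangent space at \<open>p\<close>.\<close>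

type_synonym 'm mvfield = "'m \<Rightarrow> 'm covec list \<Rightarrow> real"

definition mv_apply ::
    "('m::{t2_space,second_countable_topology}, 'e::euclidean_space) chart set
      \<Rightarrow> 'm mvfield \<Rightarrow> ('m \<Rightarrow> real) list \<Rightarrow> 'm \<Rightarrow> real"
  where "mv_apply A P fs = (\<lambda>p. P p (map (\<lambda>f. differential A f p) fs))"

definition multivector_field ::
    "('m::{t2_space,second_countable_topology}, 'e::euclidean_space) chart set
      \<Rightarrow> nat \<Rightarrow> 'm mvfield \<Rightarrow> bool"
  where "multivector_field A k P \<longleftrightarrow>
    (\<forall>p. alternating_multilinear (cotangent_space A p) k (P p)) \<and>
    (\<forall>fs\<in>lists (smooth_functions A). length fs = k \<longrightarrow> mv_apply A P fs \<in> smooth_functions A)"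

definition wedge :: "'m tvec \<Rightarrow> 'm tvec \<Rightarrow> 'm covec list \<Rightarrow> real"
  where "wedge u v = (\<lambda>\<alpha>s. (\<alpha>s ! 0) u * (\<alpha>s ! 1) v - (\<alpha>s ! 0) v * (\<alpha>s ! 1) u)"

definition shuffle_perms :: "nat \<Rightarrow> nat \<Rightarrow> (nat \<Rightarrow> nat) set"
  where "shuffle_perms k l = {\<sigma>. \<sigma> permutes {..<k + l} \<and>
    strict_mono_on {..<k} \<sigma> \<and> strict_mono_on {k..<k + l} \<sigma>}"

text \<open>The Schouten--Nijenhuis bracket of a \<open>k\<close>-vector field \<open>P\<close> and an \<open>l\<close>-vector field \<open>Q\<close>
  (\<open>k, l \<ge> 1\<close>), as a skew-symmetric multiderivation of the algebra of smooth functions: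
  \<open>[P,Q](f\<^sub>0,\<dots>)\<close> is the signed sum of
  \<open>P(Q(f\<^sub>\<sigma>\<^sub>(\<^sub>0\<^sub>),\<dots>), f\<^sub>\<sigma>\<^sub>(\<^sub>l\<^sub>),\<dots>)\<close> over \<open>(l,k-1)\<close>-shuffles minus \<open>(-1)\<close> to the power \<open>(k-1)(l-1)\<close>
  times the same sum with \<open>P\<close> and \<open>Q\<close> exchanged. For \<open>k = l = 1\<close> it is the Lie bracket.\<close>

definition insertion_sum ::
    "('m::{t2_space,second_countable_topology}, 'e::euclidean_space) chart set
      \<Rightarrow> nat \<Rightarrow> nat \<Rightarrow> 'm mvfield \<Rightarrow> 'm mvfield \<Rightarrow> ('m \<Rightarrow> real) list \<Rightarrow> 'm \<Rightarrow> real"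
  where "insertion_sum A k l P Q fs = (\<lambda>p. \<Sum>\<sigma>\<in>shuffle_perms l (k - 1).
    of_int (sign \<sigma>) * mv_apply A P
      (mv_apply A Q (map (\<lambda>i. fs ! \<sigma> i) [0..<l]) # map (\<lambda>i. fs ! \<sigma> i) [l..<l + (k - 1)]) p)"

definition schouten_bracket ::
    "('m::{t2_space,second_countable_topology}, 'e::euclidean_space) chart set
      \<Rightarrow> nat \<Rightarrow> nat \<Rightarrow> 'm mvfield \<Rightarrow> 'm mvfield \<Rightarrow> ('m \<Rightarrow> real) list \<Rightarrow> 'm \<Rightarrow> real"
  where "schouten_bracket A k l P Q fs = (\<lambda>p. insertion_sum A k l P Q fs p -
    (-1) ^ ((k - 1) * (l - 1)) * insertion_sum A l k Q P fs p)"

definition poisson_structure ::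
    "('m::{t2_space,second_countable_topology}, 'e::euclidean_space) chart set \<Rightarrow> 'm mvfield \<Rightarrow> bool"
  where "poisson_structure A \<pi> \<longleftrightarrow> multivector_field A 2 \<pi> \<and>
    (\<forall>fs\<in>lists (smooth_functions A). length fs = 3 \<longrightarrow> schouten_bracket A 2 2 \<pi> \<pi> fs = 0)"

text \<open>\<open>\<pi>(\<alpha>,\<cdot>)\<close> as a tangent vector, under the identification of a
  (finite-dimensional) tangent space with its bidual.\<close>

definition sharp ::
    "('m::{t2_space,second_countable_topology}, 'e::euclidean_space) chart set
      \<Rightarrow> 'm mvfield \<Rightarrow> 'm \<Rightarrow> 'm covec \<Rightarrow> 'm tvec"
  where "sharp A \<pi> p \<alpha> =
    (THE v. v \<in> tangent_space A p \<and> (\<forall>\<beta>\<in>cotangent_space A p. \<beta> v = \<pi> p [\<alpha>, \<beta>]))"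

definition bivector_rank ::
    "('m::{t2_space,second_countable_topology}, 'e::euclidean_space) chart set
      \<Rightarrow> 'm mvfield \<Rightarrow> 'm \<Rightarrow> nat"
  where "bivector_rank A \<pi> p = dim (sharp A \<pi> p ` cotangent_space A p)"

definition hamiltonian ::
    "('m::{t2_space,second_countable_topology}, 'e::euclidean_space) chart set
      \<Rightarrow> 'm mvfield \<Rightarrow> 'm vfield \<Rightarrow> bool"
  where "hamiltonian A \<pi> X \<longleftrightarrow>
    (\<exists>f\<in>smooth_functions A. \<forall>p. X p = sharp A \<pi> p (differential A f p))"

end

theory Submission
  imports Defs
begin

text \<open>Evaluated on a frame \<open>Y\<close>, the identity \<open>L\<^sub>X L\<^sub>Z \<Omega> - L\<^sub>Z L\<^sub>X \<Omega> = L\<^sub>[\<^sub>X\<^sub>,\<^sub>Z\<^sub>] \<Omega>\<close> reads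
  \<open>X(div Z) \<Omega>(Y) = \<Sum>\<^sub>i Y\<^sub>i(\<lambda>) \<Omega>(\<dots>,X,\<dots>)\<close>, and Cramer's rule identifies the right-hand side with \<open>X(\<lambda>) \<Omega>(Y)\<close>;
  hence \<open>X h = 0\<close>. The divergence exists because \<open>L\<^sub>Z \<Omega>\<close> is tensorial and tangent spaces have dimension
  at most \<open>n\<close>, which comes from Hadamard's lemma. With \<open>k = L\<^sub>Z h\<close>, the bracket of \<open>\<pi>\<close> satisfies
  \<open>k {f,g} = Z(f) X(g) - X(f) Z(g)\<close> on all of \<open>M\<close>, since \<open>X\<close> vanishes off its support. Together with bump
  functions off the support this gives smoothness, and applying \<open>X\<close> and \<open>Z\<close> to it gives the Jacobi
  identity. Finally \<open>\<pi>\<^sup>\<sharp>dh = (Z(h) X - X(h) Z) / k = X\<close>.\<close>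

section \<open>Calculus of smooth functions on open sets\<close>

text \<open>Tangent vectors are derivations of globally defined functions, and the Lie derivative of
  a form is given only on global vector fields. Local arguments therefore have to be globalized:
  coordinates and coefficients are multiplied by bump functions, or by the value
  \<open>FA Es\<close> of the volume form on global fields that are a frame at one point, and
  smoothness of a quotient f is recovered from an equation w f = u. The divergence is a definite
  description, so existence and uniqueness must be established: L_Z \<Omega> at p has to be shown to
  depend only on the values of the fields at p before it can be compared with \<Omega>. Dimension
  zero is split off, because a chart image is then at most a point and not an open set of the
  coordinate space; every function is smooth there and every tangent vector is 0.\<close>

lemma has_derivative_cong_on:
  assumes "x \<in> S" "\<And>x. x \<in> S \<Longrightarrow> f x = g x"
  shows "(f has_derivative D) (at x within S) \<longleftrightarrow> (g has_derivative D) (at x within S)"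
  using has_derivative_transform[OF assms(1), of f g D] has_derivative_transform[OF assms(1), of g f D]
    assms(2) by auto

lemma Ck_on_cong:
  assumes "\<And>x. x \<in> S \<Longrightarrow> f x = g x"
  shows "Ck_on k S f \<longleftrightarrow> Ck_on k S g"
  using assms
proof (induction k arbitrary: f g)
  case 0
  then show ?case by (auto intro: continuous_on_cong[THEN iffD1])
next
  case (Suc k)
  have D: "(f has_derivative D) (at x within S) \<longleftrightarrow> (g has_derivative D) (at x within S)"
    if "x \<in> S" for x D
    using has_derivative_cong_on[OF that Suc.prems] .
  have fd: "frechet_derivative f (at x within S) = frechet_derivative g (at x within S)" if "x \<in> S" for x
    by (simp add: frechet_derivative_def D[OF that])
  have "f differentiable_on S \<longleftrightarrow> g differentiable_on S"
    by (simp add: differentiable_on_def differentiable_def D)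
  moreover have "Ck_on k S (\<lambda>x. frechet_derivative f (at x within S) v) \<longleftrightarrow>
      Ck_on k S (\<lambda>x. frechet_derivative g (at x within S) v)" for v
    by (rule Suc.IH) (simp add: fd)
  ultimately show ?case by simp
qed

text \<open>On an open set the derivative within S is the full derivative. Together with
  \<open>Ck_on_SucD\<close> this rule replaces the recursive equation, which is removed from the
  simplifier further down.\<close>

lemma Ck_on_SucI:
  assumes "open S" "\<And>x. x \<in> S \<Longrightarrow> (f has_derivative f' x) (at x)"
    and "\<And>v. Ck_on k S (\<lambda>x. f' x v)"
  shows "Ck_on (Suc k) S f"
proof -
  have "frechet_derivative f (at x within S) = f' x" if "x \<in> S" for x
    using frechet_derivative_at[OF assms(2)[OF that]] at_within_open[OF that assms(1)] by simp
  then have "Ck_on k S (\<lambda>x. frechet_derivative f (at x within S) v)" for v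
    using Ck_on_cong[of S "\<lambda>x. frechet_derivative f (at x within S) v" "\<lambda>x. f' x v"] assms(3) by simp
  moreover have "f differentiable_on S"
    unfolding differentiable_on_def differentiable_def using assms(2) has_derivative_at_withinI by blast
  ultimately show ?thesis by simp
qed

lemma Ck_on_SucD:
  assumes "open S" "Ck_on (Suc k) S f"
  shows "x \<in> S \<Longrightarrow> (f has_derivative frechet_derivative f (at x)) (at x)"
    and "Ck_on k S (\<lambda>x. frechet_derivative f (at x) v)"
proof -
  show "(f has_derivative frechet_derivative f (at x)) (at x)" if "x \<in> S"
    using assms that frechet_derivative_works[of f "at x"] at_within_open[OF that assms(1)]
    by (auto simp: differentiable_on_def)
  have "Ck_on k S (\<lambda>x. frechet_derivative f (at x within S) v)" using assms(2) by simp
  then show "Ck_on k S (\<lambda>x. frechet_derivative f (at x) v)"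
    by (subst Ck_on_cong[where g="\<lambda>x. frechet_derivative f (at x within S) v"])
      (simp_all add: at_within_open[OF _ assms(1)])
qed

lemma Ck_on_continuous: "Ck_on k S f \<Longrightarrow> continuous_on S f"
  by (cases k) (auto intro: differentiable_imp_continuous_on)

lemma Ck_on_Suc_imp: "Ck_on (Suc k) S f \<Longrightarrow> Ck_on k S f"
proof (induction k arbitrary: f)
  case 0
  then show ?case using Ck_on_continuous[of "Suc 0" S f] by (simp only: Ck_on.simps(1))
qed (auto simp: Ck_on.simps(2))

declare Ck_on.simps(2) [simp del]

lemma Ck_on_subset:
  assumes "open S" "open T" "T \<subseteq> S" "Ck_on k S f" shows "Ck_on k T f"
  using assms(4)
proof (induction k arbitrary: f)
  case 0
  then show ?case using assms(3) continuous_on_subset by auto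
next
  case (Suc k)
  show ?case
    using Suc.IH[OF Ck_on_SucD(2)[OF assms(1) Suc.prems]] Ck_on_SucD(1)[OF assms(1) Suc.prems] assms
    by (intro Ck_on_SucI[where f'="\<lambda>x. frechet_derivative f (at x)"]) auto
qed

lemma Ck_on_local:
  assumes "open S" "\<And>x. x \<in> S \<Longrightarrow> \<exists>T. open T \<and> x \<in> T \<and> T \<subseteq> S \<and> Ck_on k T f"
  shows "Ck_on k S f"
  using assms(2)
proof (induction k arbitrary: f)
  case 0
  have "isCont f x" if "x \<in> S" for x
    using 0[OF that] continuous_on_eq_continuous_at by auto
  then show ?case by (simp add: continuous_at_imp_continuous_on)
next
  case (Suc k)
  show ?case
  proof (rule Ck_on_SucI[where f'="\<lambda>x. frechet_derivative f (at x)"])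
    show "(f has_derivative frechet_derivative f (at x)) (at x)" if "x \<in> S" for x
      using Suc.prems[OF that] Ck_on_SucD(1) by blast
    show "Ck_on k S (\<lambda>x. frechet_derivative f (at x) v)" for v
      proof (rule Suc.IH)
      fix x assume "x \<in> S"
      then obtain T where "open T" "x \<in> T" "T \<subseteq> S" "Ck_on (Suc k) T f" using Suc.prems by blast
      then show "\<exists>T. open T \<and> x \<in> T \<and> T \<subseteq> S \<and> Ck_on k T (\<lambda>x. frechet_derivative f (at x) v)"
        using Ck_on_SucD(2) by blast
    qed
  qed fact
qed

lemma Ck_on_const: "open S \<Longrightarrow> Ck_on k S (\<lambda>x. c)"
proof (induction k arbitrary: c)
  case (Suc k)
  then show ?case by (intro Ck_on_SucI[where f'="\<lambda>x v. 0"]) auto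
qed auto

lemma Ck_on_add:
  assumes "open S" "Ck_on k S f" "Ck_on k S g" shows "Ck_on k S (\<lambda>x. f x + g x)"
  using assms(2,3)
proof (induction k arbitrary: f g)
  case 0
  then show ?case by (auto intro: continuous_on_add)
next
  case (Suc k)
  note F = Ck_on_SucD[OF assms(1) Suc.prems(1)] and G = Ck_on_SucD[OF assms(1) Suc.prems(2)]
  show ?case
    by (rule Ck_on_SucI[where f'="\<lambda>x v. frechet_derivative f (at x) v + frechet_derivative g (at x) v"])
      (use assms(1) in \<open>auto intro: has_derivative_add F(1) G(1) Suc.IH F(2) G(2)\<close>)
qed

lemma Ck_on_mult:
  fixes f g :: "'a::real_normed_vector \<Rightarrow> real"
  assumes "open S" "Ck_on k S f" "Ck_on k S g" shows "Ck_on k S (\<lambda>x. f x * g x)"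
  using assms(2,3)
proof (induction k arbitrary: f g)
  case 0
  then show ?case by (auto intro: continuous_on_mult)
next
  case (Suc k)
  note F = Ck_on_SucD[OF assms(1) Suc.prems(1)] and G = Ck_on_SucD[OF assms(1) Suc.prems(2)]
  show ?case
    by (rule Ck_on_SucI[where f'="\<lambda>x v. f x * frechet_derivative g (at x) v + frechet_derivative f (at x) v * g x"])
      (use assms(1) in \<open>auto intro!: has_derivative_mult F(1) G(1) Ck_on_add Suc.IH F(2) G(2)
          Suc.prems[THEN Ck_on_Suc_imp]\<close>)
qed

lemma Ck_on_sum:
  assumes "open S" "\<And>i. i \<in> I \<Longrightarrow> Ck_on k S (f i)" shows "Ck_on k S (\<lambda>x. \<Sum>i\<in>I. f i x)"
  using assms(2)
  by (induction I rule: infinite_finite_induct) (auto intro: Ck_on_const Ck_on_add assms(1))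

lemma Ck_on_bounded_linear:
  assumes "open S" "bounded_linear L" "Ck_on k S f" shows "Ck_on k S (\<lambda>x. L (f x))"
  using assms(3)
proof (induction k arbitrary: f)
  case 0
  then show ?case by (simp add: assms(2) bounded_linear.continuous_on)
next
  case (Suc k)
  note F = Ck_on_SucD[OF assms(1) Suc.prems(1)]
  show ?case
    by (rule Ck_on_SucI[where f'="\<lambda>x v. L (frechet_derivative f (at x) v)"])
      (use assms(1) in \<open>auto intro!: Suc.IH F bounded_linear.has_derivative[OF assms(2)]\<close>)
qed

lemma Ck_on_ident: "open S \<Longrightarrow> Ck_on k S (\<lambda>x. x)"
proof (cases k)
  case (Suc l)
  then show "open S \<Longrightarrow> ?thesis"
    by (auto intro!: Ck_on_SucI[where f'="\<lambda>x v. v"] Ck_on_const)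
qed simp

text \<open>\<open>Ck_on\<close> controls derivatives only in a fixed direction, whereas the chain
  rule differentiates f in the direction \<open>frechet_derivative g (at x) v\<close>, which moves
  with x. Expanding that direction in the basis leaves fixed directions i with scalar
  coefficients.\<close>

lemma Ck_on_compose:
  fixes g :: "'a::euclidean_space \<Rightarrow> 'b::euclidean_space" and f :: "'b \<Rightarrow> real"
  assumes "open S" "open T" "g ` S \<subseteq> T" "Ck_on k S g" "Ck_on k T f"
  shows "Ck_on k S (\<lambda>x. f (g x))"
  using assms(4,5)
proof (induction k arbitrary: f)
  case 0
  then show ?case using assms(3) continuous_on_compose2 by auto
next
  case (Suc k)
  note G = Ck_on_SucD[OF assms(1) Suc.prems(1)] and F = Ck_on_SucD[OF assms(2) Suc.prems(2)]
  show ?case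
  proof (rule Ck_on_SucI[where f'="\<lambda>x v. \<Sum>i\<in>Basis. (frechet_derivative g (at x) v \<bullet> i) * frechet_derivative f (at (g x)) i"])
    fix x assume x: "x \<in> S"
    have A: "((\<lambda>x. f (g x)) has_derivative (\<lambda>v. frechet_derivative f (at (g x)) (frechet_derivative g (at x) v))) (at x)"
      using G(1)[OF x] F(1)[of "g x"] x assms(3)
      by (intro has_derivative_compose[where f=g and g=f]) auto
    have B: "frechet_derivative f (at (g x)) w = (\<Sum>i\<in>Basis. (w \<bullet> i) * frechet_derivative f (at (g x)) i)" for w
    proof -
      have L: "linear (frechet_derivative f (at (g x)))"
        using F(1)[of "g x"] x assms(3) has_derivative_linear by blast
      have "frechet_derivative f (at (g x)) w = frechet_derivative f (at (g x)) (\<Sum>i\<in>Basis. (w \<bullet> i) *\<^sub>R i)"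
        by (simp add: euclidean_representation)
      also have "\<dots> = (\<Sum>i\<in>Basis. (w \<bullet> i) * frechet_derivative f (at (g x)) i)"
        by (simp add: linear_sum[OF L] linear_scale[OF L])
      finally show ?thesis .
    qed
    show "((\<lambda>x. f (g x)) has_derivative
       (\<lambda>v. \<Sum>i\<in>Basis. (frechet_derivative g (at x) v \<bullet> i) * frechet_derivative f (at (g x)) i)) (at x)"
      by (rule has_derivative_eq_rhs[OF A]) (rule ext, rule B)
  next
    fix v
    show "Ck_on k S (\<lambda>x. \<Sum>i\<in>Basis. (frechet_derivative g (at x) v \<bullet> i) * frechet_derivative f (at (g x)) i)"
      by (intro Ck_on_sum Ck_on_mult Ck_on_bounded_linear[OF assms(1) bounded_linear_inner_left]
          assms(1) G(2) Suc.IH F(2) Ck_on_Suc_imp[OF Suc.prems(1)])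
  qed fact
qed

text \<open>The derivative -f'/f^2 contains the inverse itself, which the induction hypothesis
  covers at the lower order.\<close>

lemma Ck_on_inverse:
  fixes f :: "'a::real_normed_vector \<Rightarrow> real"
  assumes "open S" "\<And>x. x \<in> S \<Longrightarrow> f x \<noteq> 0" "Ck_on k S f"
  shows "Ck_on k S (\<lambda>x. inverse (f x))"
  using assms(3)
proof (induction k)
  case 0
  then show ?case using assms(2) by (auto intro: continuous_on_inverse)
next
  case (Suc k)
  note F = Ck_on_SucD[OF assms(1) Suc.prems]
  have I: "Ck_on k S (\<lambda>x. inverse (f x))" using Suc Ck_on_Suc_imp by blast
  show ?case
  proof (rule Ck_on_SucI[where f'="\<lambda>x v. - 1 * (inverse (f x) * frechet_derivative f (at x) v * inverse (f x))"])
    show "((\<lambda>x. inverse (f x)) has_derivative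
      (\<lambda>v. - 1 * (inverse (f x) * frechet_derivative f (at x) v * inverse (f x)))) (at x)" if "x \<in> S" for x
      using Deriv.has_derivative_inverse[OF assms(2)[OF that] F(1)[OF that]] by simp
  qed (intro assms(1) Ck_on_mult Ck_on_const I F(2))+
qed

lemmas smooth_on_Ck = smooth_on_def[THEN iffD1, rule_format]

lemma smooth_onI: "(\<And>k. Ck_on k S f) \<Longrightarrow> smooth_on S f"
  by (simp add: smooth_on_def)

lemma smooth_on_continuous: "smooth_on S f \<Longrightarrow> continuous_on S f"
  using smooth_on_Ck[of S f 0] by simp

lemma smooth_on_eq:
  "smooth_on S g \<Longrightarrow> (\<And>x. x \<in> S \<Longrightarrow> f x = g x) \<Longrightarrow> smooth_on S f"
  using Ck_on_cong[of S f g] by (simp add: smooth_on_def)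

lemma smooth_on_subset: "open S \<Longrightarrow> open T \<Longrightarrow> T \<subseteq> S \<Longrightarrow> smooth_on S f \<Longrightarrow> smooth_on T f"
  by (meson smooth_on_def Ck_on_subset)

lemma smooth_on_local:
  assumes "open S" "\<And>x. x \<in> S \<Longrightarrow> \<exists>T. open T \<and> x \<in> T \<and> T \<subseteq> S \<and> smooth_on T f"
  shows "smooth_on S f"
  by (intro smooth_onI Ck_on_local[OF assms(1)]) (meson assms(2) smooth_on_def)

lemma smooth_on_const: "open S \<Longrightarrow> smooth_on S (\<lambda>x. c)"
  by (simp add: smooth_onI Ck_on_const)

lemma smooth_on_ident: "open S \<Longrightarrow> smooth_on S (\<lambda>x. x)"
  by (simp add: smooth_onI Ck_on_ident)

lemma smooth_on_add: "open S \<Longrightarrow> smooth_on S f \<Longrightarrow> smooth_on S g \<Longrightarrow> smooth_on S (\<lambda>x. f x + g x)"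
  by (simp add: smooth_on_def Ck_on_add)

lemma smooth_on_mult:
  fixes f g :: "'a::real_normed_vector \<Rightarrow> real"
  shows "open S \<Longrightarrow> smooth_on S f \<Longrightarrow> smooth_on S g \<Longrightarrow> smooth_on S (\<lambda>x. f x * g x)"
  by (simp add: smooth_on_def Ck_on_mult)

lemma smooth_on_sum:
  "open S \<Longrightarrow> (\<And>i. i \<in> I \<Longrightarrow> smooth_on S (f i)) \<Longrightarrow> smooth_on S (\<lambda>x. \<Sum>i\<in>I. f i x)"
  by (simp add: smooth_on_def Ck_on_sum)

lemma smooth_on_inner_left: "open S \<Longrightarrow> smooth_on S f \<Longrightarrow> smooth_on S (\<lambda>x. f x \<bullet> i)"
  by (simp add: smooth_on_def Ck_on_bounded_linear[OF _ bounded_linear_inner_left])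

lemma smooth_on_compose:
  fixes g :: "'a::euclidean_space \<Rightarrow> 'b::euclidean_space" and f :: "'b \<Rightarrow> real"
  shows "open S \<Longrightarrow> open T \<Longrightarrow> g ` S \<subseteq> T \<Longrightarrow> smooth_on S g \<Longrightarrow> smooth_on T f \<Longrightarrow>
    smooth_on S (\<lambda>x. f (g x))"
  by (simp add: smooth_on_def Ck_on_compose)

lemma smooth_on_inverse:
  fixes f :: "'a::real_normed_vector \<Rightarrow> real"
  shows "open S \<Longrightarrow> (\<And>x. x \<in> S \<Longrightarrow> f x \<noteq> 0) \<Longrightarrow> smooth_on S f \<Longrightarrow>
    smooth_on S (\<lambda>x. inverse (f x))"
  by (simp add: smooth_on_def Ck_on_inverse)

lemma smooth_on_has_derivative:
  "open S \<Longrightarrow> smooth_on S f \<Longrightarrow> x \<in> S \<Longrightarrow> (f has_derivative frechet_derivative f (at x)) (at x)"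
  using Ck_on_SucD(1)[of S 0 f x] smooth_on_Ck[of S f] by blast

lemma smooth_on_frechet_derivative:
  "open S \<Longrightarrow> smooth_on S f \<Longrightarrow> smooth_on S (\<lambda>x. frechet_derivative f (at x) v)"
  by (rule smooth_onI) (rule Ck_on_SucD(2), simp_all add: smooth_on_Ck)

section \<open>The flat function exp(-1/x) and bump functions\<close>

text \<open>The classical flat function is the case k = 0. The factor x^(-k) closes the family under
  differentiation, so that smoothness follows by induction on the order for all k at once.\<close>

definition flat_exp :: "nat \<Rightarrow> real \<Rightarrow> real"
  where "flat_exp k x = (if x > 0 then inverse x ^ k * exp (- inverse x) else 0)"

lemma flat_exp_tendsto_0: "(flat_exp k \<longlongrightarrow> 0) (at 0)"
proof -
  have "((\<lambda>x. inverse x ^ k / exp (inverse x)) \<longlongrightarrow> (0::real)) (at_right 0)"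
    by (rule filterlim_compose[OF tendsto_power_div_exp_0 filterlim_inverse_at_top_right])
  moreover have "\<forall>\<^sub>F x in at_right 0. inverse x ^ k / exp (inverse x) = flat_exp k x"
    unfolding eventually_at_filter by (auto simp: flat_exp_def exp_minus divide_inverse)
  ultimately have "(flat_exp k \<longlongrightarrow> 0) (at_right 0)"
    by (rule Lim_transform_eventually)
  moreover have "(flat_exp k \<longlongrightarrow> 0) (at_left 0)"
    by (rule tendsto_eventually) (auto simp: eventually_at_filter flat_exp_def)
  ultimately show ?thesis by (simp add: filterlim_split_at)
qed

lemma flat_exp_has_derivative:
  "(flat_exp k has_real_derivative (flat_exp (k + 2) x - real k * flat_exp (k + 1) x)) (at x)"
proof -
  consider "x > 0" | "x < 0" | "x = 0" by linarith
  then show ?thesis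
  proof cases
    case 1
    have "((\<lambda>x. inverse x ^ k * exp (- inverse x)) has_real_derivative
        (flat_exp (k + 2) x - real k * flat_exp (k + 1) x)) (at x)"
      using 1 by (cases k)
        (auto intro!: derivative_eq_intros simp: flat_exp_def field_simps power2_eq_square,
          metis One_nat_def power_eq_if)
    then show ?thesis
      by (rule has_field_derivative_transform_within[where d=x]) (use 1 in \<open>auto simp: flat_exp_def dist_real_def\<close>)
  next
    case 2
    have "((\<lambda>x. 0) has_real_derivative
        (flat_exp (k + 2) x - real k * flat_exp (k + 1) x)) (at x)"
      using 2 by (auto simp: flat_exp_def)
    then show ?thesis
      by (rule has_field_derivative_transform_within[where d="-x"]) (use 2 in \<open>auto simp: flat_exp_def dist_real_def\<close>)
  next
    case 3
    \<comment> \<open>At 0 the difference quotient is the next member of the family, which tends to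
      0; the claimed derivative is 0 there as well, since every \<open>flat_exp\<close> vanishes at
      0.\<close>
    have "(\<lambda>h. (flat_exp k (0 + h) - flat_exp k 0) / h) = flat_exp (Suc k)"
      by (auto simp: flat_exp_def fun_eq_iff field_simps)
    then show ?thesis
      using flat_exp_tendsto_0[of "Suc k"] 3 by (simp add: DERIV_def flat_exp_def[of _ 0])
  qed
qed

lemma smooth_on_flat_exp: "smooth_on UNIV (flat_exp k)"
proof (rule smooth_onI)
  fix m show "Ck_on m UNIV (flat_exp k)"
  proof (induction m arbitrary: k)
    case 0
    then show ?case
      by (auto simp: continuous_on_eq_continuous_at intro: DERIV_isCont[OF flat_exp_has_derivative])
  next
    case (Suc m)
    have "Ck_on m UNIV (\<lambda>x. (flat_exp (k + 2) x + - real k * flat_exp (k + 1) x) * v)" for v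
      by (intro Ck_on_mult Ck_on_add Ck_on_const Suc open_UNIV)
    then show ?case
      by (intro Ck_on_SucI[where f'="\<lambda>x v. (flat_exp (k + 2) x + - real k * flat_exp (k + 1) x) * v"])
        (use flat_exp_has_derivative in \<open>auto simp: has_field_derivative_def\<close>)
  qed
qed

text \<open>Radius and distance enter squared: the squared norm is a polynomial in the coordinates,
  hence smooth at the centre too, where the norm is not.\<close>

definition bump :: "'e::euclidean_space \<Rightarrow> real \<Rightarrow> 'e \<Rightarrow> real"
  where "bump a r x = flat_exp 0 (r\<^sup>2 - (norm (x - a))\<^sup>2)"

lemma bump_nonzero_iff: "r > 0 \<Longrightarrow> bump a r x \<noteq> 0 \<longleftrightarrow> x \<in> ball a r"
  using power_mono_iff[of r "norm (a - x)" 2]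
  by (auto simp: not_le[symmetric] bump_def flat_exp_def dist_norm norm_minus_commute)

lemma smooth_on_bump: "smooth_on UNIV (bump a r)"
proof -
  have "(norm (x - a))\<^sup>2 = (\<Sum>i\<in>Basis. ((x - a) \<bullet> i) * ((x - a) \<bullet> i))" for x
    by (subst power2_norm_eq_inner) (rule euclidean_inner)
  then have "(\<lambda>x. r\<^sup>2 - (norm (x - a))\<^sup>2) =
      (\<lambda>x. r\<^sup>2 + (-1) * (\<Sum>i\<in>Basis. (x \<bullet> i + - (a \<bullet> i)) * (x \<bullet> i + - (a \<bullet> i))))"
    by (simp add: fun_eq_iff inner_diff_left)
  moreover have "smooth_on UNIV \<dots>"
    by (intro smooth_on_add smooth_on_mult smooth_on_sum smooth_on_inner_left smooth_on_const
        smooth_on_ident open_UNIV)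
  ultimately have "smooth_on UNIV (\<lambda>x. r\<^sup>2 - (norm (x - a))\<^sup>2)" by simp
  then show ?thesis
    unfolding bump_def by (intro smooth_on_compose[OF _ _ _ _ smooth_on_flat_exp]) auto
qed

section \<open>Radial averages and Hadamard's lemma\<close>

lemma segment_in_ball:
  fixes a x :: "'e::real_normed_vector"
  assumes "x \<in> ball a R" "t \<in> {0..1}" shows "a + t *\<^sub>R (x - a) \<in> ball a R"
proof -
  have "norm (t *\<^sub>R (x - a)) \<le> norm (x - a)"
    using assms(2) by (simp add: mult_left_le_one_le)
  then show ?thesis using assms(1) by (simp add: dist_norm norm_minus_commute)
qed

lemma continuous_on_segment_compose:
  fixes u :: "'e::real_normed_vector \<Rightarrow> real"
  assumes "continuous_on (ball a R) u"
  shows "continuous_on (ball a R \<times> cbox 0 (1::real)) (\<lambda>(x, t). t ^ m * u (a + t *\<^sub>R (x - a)))"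
  unfolding case_prod_beta
  by (intro continuous_intros continuous_on_compose2[OF assms])
    (auto intro!: segment_in_ball simp del: mem_ball)

lemma integrable_on_segment:
  fixes u :: "'e::real_normed_vector \<Rightarrow> real"
  assumes "continuous_on (ball a R) u" "x \<in> ball a R"
  shows "(\<lambda>t. t ^ m * u (a + t *\<^sub>R (x - a))) integrable_on cbox 0 (1::real)"
  by (intro integrable_continuous continuous_intros continuous_on_compose2[OF assms(1)])
    (use assms(2) in \<open>auto intro!: segment_in_ball simp del: mem_ball\<close>)

text \<open>The weight t^m is there for the induction: differentiating under the integral produces
  one more factor t by the chain rule, so the derivative in direction v is the average of the
  directional derivative of u with weight t^(m+1).\<close>

lemma Ck_on_radial_average:
  fixes u :: "'e::euclidean_space \<Rightarrow> real"
  assumes "smooth_on (ball a R) u"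
  shows "Ck_on k (ball a R) (\<lambda>x. integral (cbox 0 1) (\<lambda>t. t ^ m * u (a + t *\<^sub>R (x - a))))"
  using assms
proof (induction k arbitrary: m u)
  case 0
  then show ?case
    using integral_continuous_on_param[OF continuous_on_segment_compose[OF smooth_on_continuous]]
    by fastforce
next
  case (Suc k)
  let ?d = "\<lambda>x. frechet_derivative u (at x)"
  let ?I = "\<lambda>x v. integral (cbox 0 1) (\<lambda>t. t ^ Suc m * ?d (a + t *\<^sub>R (x - a)) v)"
  note dsm = smooth_on_frechet_derivative[OF open_ball Suc.prems]
  note hd = smooth_on_has_derivative[OF open_ball Suc.prems]
  \<comment> \<open>The Leibniz rule for parameter integrals asks for the derivative of the
    integrand as a bounded linear map, jointly continuous in x and t.\<close>
  define fx where "fx = (\<lambda>x t. Blinfun (\<lambda>v. t ^ Suc m * ?d (a + t *\<^sub>R (x - a)) v))"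
  have fx: "blinfun_apply (fx x t) = (\<lambda>v. t ^ Suc m * ?d (a + t *\<^sub>R (x - a)) v)"
    if "x \<in> ball a R" "t \<in> cbox 0 1" for x t
    unfolding fx_def
    using hd[OF segment_in_ball, of x t] that
    by (intro bounded_linear_Blinfun_apply bounded_linear_const_mult) (auto dest: has_derivative_bounded_linear)
  have cont: "continuous_on (ball a R \<times> cbox 0 1) (\<lambda>(x, t). fx x t)"
  proof (rule continuous_on_blinfun_componentwise)
    fix i :: 'e
    have "continuous_on (ball a R \<times> cbox 0 1) (\<lambda>(x, t). t ^ Suc m * ?d (a + t *\<^sub>R (x - a)) i)"
      by (rule continuous_on_segment_compose[OF smooth_on_continuous[OF dsm]])
    then show "continuous_on (ball a R \<times> cbox 0 1) (\<lambda>y. blinfun_apply (case y of (x, t) \<Rightarrow> fx x t) i)"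
      by (rule continuous_on_eq) (auto simp: fx simp del: mem_ball)
  qed
  have der: "((\<lambda>x. integral (cbox 0 1) (\<lambda>t. t ^ m * u (a + t *\<^sub>R (x - a)))) has_derivative ?I x) (at x)"
    if x: "x \<in> ball a R" for x
  proof -
    have "((\<lambda>x. integral (cbox 0 1) (\<lambda>t. t ^ m * u (a + t *\<^sub>R (x - a)))) has_derivative
        blinfun_apply (integral (cbox 0 1) (fx x))) (at x within ball a R)"
    proof (rule leibniz_rule[where fx=fx])
      fix y t assume y: "y \<in> ball a R" and t: "t \<in> cbox (0::real) 1"
      have s: "a + t *\<^sub>R (y - a) \<in> ball a R" using segment_in_ball[OF y] t by simp
      have "((\<lambda>x. u (a + t *\<^sub>R (x - a))) has_derivative (\<lambda>v. ?d (a + t *\<^sub>R (y - a)) (t *\<^sub>R v))) (at y)"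
        by (rule has_derivative_compose[where f="\<lambda>x. a + t *\<^sub>R (x - a)" and g=u, OF _ hd[OF s]])
          (auto intro!: derivative_eq_intros)
      then have "((\<lambda>x. t ^ m * u (a + t *\<^sub>R (x - a))) has_derivative
          (\<lambda>v. t ^ m * ?d (a + t *\<^sub>R (y - a)) (t *\<^sub>R v))) (at y)"
        by (rule has_derivative_mult_right)
      moreover have "?d (a + t *\<^sub>R (y - a)) (t *\<^sub>R v) = t * ?d (a + t *\<^sub>R (y - a)) v" for v
        using linear_scale[OF has_derivative_linear[OF hd[OF s]], of t v] by simp
      ultimately show "((\<lambda>x. t ^ m * u (a + t *\<^sub>R (x - a))) has_derivative blinfun_apply (fx y t)) (at y within ball a R)"
        unfolding fx[OF y t] by (auto intro: has_derivative_at_withinI simp: ac_simps)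
    next
      fix y assume y: "y \<in> ball a R"
      show "(\<lambda>t. t ^ m * u (a + t *\<^sub>R (y - a))) integrable_on cbox 0 1"
        by (rule integrable_on_segment[OF smooth_on_continuous[OF Suc.prems] y])
    qed (use x cont in auto)
    moreover have "blinfun_apply (integral (cbox 0 1) (fx x)) v = ?I x v" for v
    proof -
      have "fx x integrable_on cbox 0 1"
        by (rule integrable_continuous, rule continuous_on_compose2[OF cont, of _ "\<lambda>t. (x, t)", simplified])
          (use x in \<open>auto intro!: continuous_intros\<close>)
      then show ?thesis
        unfolding blinfun_apply_integral[OF \<open>fx x integrable_on cbox 0 1\<close>]
        by (intro integral_cong) (use x in \<open>auto simp: fx\<close>)
    qed
    then have "blinfun_apply (integral (cbox 0 1) (fx x)) = ?I x" by blast
    ultimately show ?thesis using at_within_open[OF x open_ball] by simp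
  qed
  show ?case
    by (rule Ck_on_SucI[OF open_ball der Suc.IH[OF dsm]])
qed

text \<open>f x - f a is the integral of the derivative of f along the segment from a to x. That
  derivative is linear in the direction x - a, so the integral splits over the basis, and
  \<open>g i\<close> is the average of the i-th partial derivative.\<close>

lemma hadamard:
  fixes f :: "'e::euclidean_space \<Rightarrow> real"
  assumes "smooth_on (ball a R) f" "R > 0"
  obtains g where "\<And>i. smooth_on (ball a R) (g i)"
    and "\<And>i. g i a = frechet_derivative f (at a) i"
    and "\<And>x. x \<in> ball a R \<Longrightarrow> f x = f a + (\<Sum>i\<in>Basis. ((x - a) \<bullet> i) * g i x)"
proof
  let ?d = "\<lambda>x. frechet_derivative f (at x)"
  note dsm = smooth_on_frechet_derivative[OF open_ball assms(1)]
  note hd = smooth_on_has_derivative[OF open_ball assms(1)]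
  \<comment> \<open>The trivial weight t^0 gives the integrand the shape treated by
    \<open>Ck_on_radial_average\<close>.\<close>
  let ?g = "\<lambda>i x. integral (cbox 0 1) (\<lambda>t. t ^ 0 * ?d (a + t *\<^sub>R (x - a)) i)"
  show "smooth_on (ball a R) (?g i)" for i
    by (intro smooth_onI Ck_on_radial_average dsm)
  show "?g i a = ?d a i" for i by simp
  fix x assume x: "x \<in> ball a R"
  have int: "(\<lambda>t. t ^ 0 * ?d (a + t *\<^sub>R (x - a)) i) integrable_on cbox 0 1" for i
    by (rule integrable_on_segment[OF smooth_on_continuous[OF dsm] x])
  have "((\<lambda>t. ?d (a + t *\<^sub>R (x - a)) (x - a)) has_integral (f (a + 1 *\<^sub>R (x - a)) - f (a + 0 *\<^sub>R (x - a)))) {0..1}"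
  proof (rule fundamental_theorem_of_calculus)
    fix t :: real assume t: "t \<in> {0..1}"
    note s = segment_in_ball[OF x t]
    have "((\<lambda>t. f (a + t *\<^sub>R (x - a))) has_derivative (\<lambda>h. ?d (a + t *\<^sub>R (x - a)) (h *\<^sub>R (x - a)))) (at t)"
      by (rule has_derivative_compose[where f="\<lambda>t. a + t *\<^sub>R (x - a)" and g=f, OF _ hd[OF s]])
        (auto intro!: derivative_eq_intros)
    then have "((\<lambda>t. f (a + t *\<^sub>R (x - a))) has_derivative (\<lambda>h. h *\<^sub>R ?d (a + t *\<^sub>R (x - a)) (x - a))) (at t)"
      using linear_scale[OF has_derivative_linear[OF hd[OF s]]] by simp
    then show "((\<lambda>t. f (a + t *\<^sub>R (x - a))) has_vector_derivative ?d (a + t *\<^sub>R (x - a)) (x - a)) (at t within {0..1})"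
      unfolding has_vector_derivative_def using has_derivative_at_withinI by blast
  qed simp
  then have 1: "f x - f a = integral (cbox 0 1) (\<lambda>t. ?d (a + t *\<^sub>R (x - a)) (x - a))"
    by (simp add: integral_unique)
  have "integral (cbox 0 1) (\<lambda>t. ?d (a + t *\<^sub>R (x - a)) (x - a)) =
      integral (cbox 0 1) (\<lambda>t. \<Sum>i\<in>Basis. ((x - a) \<bullet> i) * (t ^ 0 * ?d (a + t *\<^sub>R (x - a)) i))"
  proof (rule integral_cong)
    fix t :: real assume "t \<in> cbox 0 1"
    then have L: "linear (?d (a + t *\<^sub>R (x - a)))"
      using has_derivative_linear[OF hd[OF segment_in_ball[OF x]], of t] by simp
    have "?d (a + t *\<^sub>R (x - a)) (x - a) = ?d (a + t *\<^sub>R (x - a)) (\<Sum>i\<in>Basis. ((x - a) \<bullet> i) *\<^sub>R i)"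
      by (simp add: euclidean_representation)
    also have "\<dots> = (\<Sum>i\<in>Basis. ((x - a) \<bullet> i) * (t ^ 0 * ?d (a + t *\<^sub>R (x - a)) i))"
      by (simp add: linear_sum[OF L] linear_scale[OF L])
    finally show "?d (a + t *\<^sub>R (x - a)) (x - a) = \<dots>" .
  qed
  also have "\<dots> = (\<Sum>i\<in>Basis. ((x - a) \<bullet> i) * ?g i x)"
    by (subst integral_sum) (auto intro!: integrable_on_mult_right int[simplified])
  finally show "f x = f a + (\<Sum>i\<in>Basis. ((x - a) \<bullet> i) * ?g i x)" using 1 by linarith
qed

section \<open>Smooth functions, tangent vectors and vector fields on a manifold\<close>

text \<open>A point of S is isolated in S, so every map is differentiable within S; whichever
  derivative is selected there, the induction hypothesis applies to it. This settles the charts in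
  dimension zero.\<close>

lemma Ck_on_subsingleton: "S \<subseteq> {a} \<Longrightarrow> Ck_on k S f"
proof (induction k arbitrary: f)
  case 0
  then show ?case by (auto simp: subset_singleton_iff)
next
  case (Suc k)
  have "at x within S = bot" if "x \<in> S" for x
    using Suc.prems that by (auto simp: at_within_eq_bot_iff subset_singleton_iff)
  then have "g differentiable_on S" for g :: "'a \<Rightarrow> 'b"
    unfolding differentiable_on_def differentiable_def
    by (metis has_derivative_bot bounded_linear_zero)
  then show ?case using Suc.IH[OF Suc.prems] by (simp add: Ck_on.simps(2))
qed

locale manifold =
  fixes n :: nat
    and A :: "('m::{t2_space,second_countable_topology}, 'e::euclidean_space) chart set"
  assumes mfd: "smooth_manifold n A"
begin

abbreviation "C \<equiv> smooth_functions A"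
abbreviation "T \<equiv> tangent_space A"
abbreviation "VF \<equiv> vector_fields A"

lemma smooth_functions_zero_dim: "C = UNIV" if "n = 0"
proof -
  have "smooth_on (\<phi> ` U) (f \<circ> inv_into U \<phi>)" if "(U, \<phi>) \<in> A" for U \<phi> and f :: "'m \<Rightarrow> real"
  proof -
    have "openin (top_of_set (model_space n)) (\<phi> ` U)"
      using mfd that by (auto simp: smooth_manifold_def)
    then have "\<phi> ` U \<subseteq> model_space n" by (rule openin_imp_subset)
    then have "\<phi> ` U \<subseteq> {0}" using \<open>n = 0\<close> by (simp add: model_space_def)
    then show ?thesis by (intro smooth_onI Ck_on_subsingleton)
  qed
  then show ?thesis by (auto simp: smooth_functions_def)
qed

lemma dim_eq: "n \<noteq> 0 \<Longrightarrow> n = DIM('e)"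
  using mfd by (auto simp: smooth_manifold_def)

lemma chart_at: obtains U \<phi> where "(U, \<phi>) \<in> A" "p \<in> U"
proof -
  have "(\<Union>(U, \<phi>) \<in> A. U) = UNIV" using mfd by (simp add: smooth_manifold_def)
  then have "p \<in> (\<Union>(U, \<phi>) \<in> A. U)" by simp
  then show ?thesis using that by auto
qed

lemma smooth_functionsI:
  "(\<And>U \<phi>. (U, \<phi>) \<in> A \<Longrightarrow> smooth_on (\<phi> ` U) (f \<circ> inv_into U \<phi>)) \<Longrightarrow> f \<in> C"
  by (auto simp: smooth_functions_def)

lemma smooth_functionsD: "f \<in> C \<Longrightarrow> (U, \<phi>) \<in> A \<Longrightarrow> smooth_on (\<phi> ` U) (f \<circ> inv_into U \<phi>)"
  by (auto simp: smooth_functions_def)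

context
  fixes U \<phi> assumes chart: "(U, \<phi>) \<in> A"
begin

lemma chart_homeomorphism: "homeomorphism U (\<phi> ` U) \<phi> (inv_into U \<phi>)"
  using mfd chart by (auto simp: smooth_manifold_def)

lemma chart_open: "open U"
  using mfd chart by (auto simp: smooth_manifold_def)

lemma chart_image_open: "n \<noteq> 0 \<Longrightarrow> open (\<phi> ` U)"
  using mfd chart by (fastforce simp: smooth_manifold_def model_space_def)

lemma chart_inv: "x \<in> U \<Longrightarrow> inv_into U \<phi> (\<phi> x) = x"
  using chart_homeomorphism by (simp add: homeomorphism_def)

lemma chart_inj: "inj_on \<phi> U"
  using chart_inv by (metis inj_onI)

lemma chart_open_image:
  assumes "n \<noteq> 0" "open W" "W \<subseteq> U" shows "open (\<phi> ` W)"
proof -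
  have "openin (top_of_set (\<phi> ` U)) (\<phi> ` W)"
    using homeomorphism_imp_open_map[OF chart_homeomorphism] assms
    by (simp add: openin_open_eq chart_open)
  then show ?thesis using chart_image_open[OF assms(1)] by (simp add: openin_open_eq)
qed

lemma chart_open_preimage:
  assumes "open O'" shows "open (U \<inter> \<phi> -` O')"
  using chart_homeomorphism assms chart_open
  by (intro continuous_open_preimage) (auto simp: homeomorphism_def)

lemma chart_transition:
  "(V, \<psi>) \<in> A \<Longrightarrow> smooth_on (\<phi> ` (U \<inter> V)) (\<psi> \<circ> inv_into U \<phi>)"
  using mfd chart by (fastforce simp: smooth_manifold_def)

end

section \<open>The algebra of smooth functions, cut-offs and bump functions\<close>

lemma C_const: "(\<lambda>x. c) \<in> C"
proof (cases "n = 0")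
  case False
  then show ?thesis
    by (intro smooth_functionsI) (simp add: o_def smooth_on_const chart_image_open)
qed (simp add: smooth_functions_zero_dim)

lemma C_add: "f \<in> C \<Longrightarrow> g \<in> C \<Longrightarrow> (\<lambda>x. f x + g x) \<in> C"
proof (cases "n = 0")
  case False
  assume "f \<in> C" "g \<in> C"
  then show ?thesis
    by (intro smooth_functionsI)
      (use smooth_on_add[OF chart_image_open[OF _ False] smooth_functionsD smooth_functionsD]
        in \<open>auto simp: o_def\<close>)
qed (simp add: smooth_functions_zero_dim)

lemma C_mult: "f \<in> C \<Longrightarrow> g \<in> C \<Longrightarrow> (\<lambda>x. f x * g x) \<in> C"
proof (cases "n = 0")
  case False
  assume "f \<in> C" "g \<in> C"
  then show ?thesis
    by (intro smooth_functionsI)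
      (use smooth_on_mult[OF chart_image_open[OF _ False] smooth_functionsD smooth_functionsD]
        in \<open>auto simp: o_def\<close>)
qed (simp add: smooth_functions_zero_dim)

lemma C_diff: "f \<in> C \<Longrightarrow> g \<in> C \<Longrightarrow> (\<lambda>x. f x - g x) \<in> C"
  using C_add[of f "\<lambda>x. (-1) * g x"] C_mult[OF C_const, of g "-1"] by simp

lemma C_sum: "(\<And>i. i \<in> I \<Longrightarrow> f i \<in> C) \<Longrightarrow> (\<lambda>x. \<Sum>i\<in>I. f i x) \<in> C"
  by (induction I rule: infinite_finite_induct) (auto intro: C_const C_add)

text \<open>Near p the function f is the quotient u/w. Since w and u are global, no local functions
  have to be patched; the divergence and the brackets of \<pi> are shown smooth in this way.\<close>

lemma smooth_of_locally_divisible: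
  assumes "\<And>p. \<exists>w\<in>C. \<exists>u\<in>C. w p \<noteq> 0 \<and> (\<forall>x. w x * f x = u x)"
  shows "f \<in> C"
proof (cases "n = 0")
  case False
  show ?thesis
  proof (rule smooth_functionsI)
    fix U \<phi> assume ch: "(U, \<phi>) \<in> A"
    note op = chart_image_open[OF ch False]
    show "smooth_on (\<phi> ` U) (f \<circ> inv_into U \<phi>)"
    proof (rule smooth_on_local[OF op])
      fix y assume "y \<in> \<phi> ` U"
      then obtain q where q: "q \<in> U" "y = \<phi> q" by auto
      obtain w u where w: "w \<in> C" "w q \<noteq> 0" and u: "u \<in> C" and eq: "\<And>x. w x * f x = u x"
        using assms by blast
      let ?i = "inv_into U \<phi>"
      define S where "S = \<phi> ` U \<inter> (w \<circ> ?i) -` (- {0})"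
      have S: "open S" unfolding S_def
        by (rule continuous_open_preimage[OF smooth_on_continuous[OF smooth_functionsD[OF w(1) ch]] op])
          auto
      have sub: "S \<subseteq> \<phi> ` U" by (auto simp: S_def)
      have "smooth_on S (\<lambda>y. (u \<circ> ?i) y * inverse ((w \<circ> ?i) y))"
        by (intro smooth_on_mult smooth_on_inverse S smooth_on_subset[OF op S sub] smooth_functionsD[OF _ ch] u w(1))
          (auto simp: S_def)
      moreover have "(f \<circ> ?i) y = (u \<circ> ?i) y * inverse ((w \<circ> ?i) y)" if "y \<in> S" for y
        using that eq[of "?i y"] by (auto simp: S_def field_simps)
      ultimately have "smooth_on S (f \<circ> ?i)" by (rule smooth_on_eq)
      moreover have "y \<in> S" using q w(2) chart_inv[OF ch] by (auto simp: S_def)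
      ultimately show "\<exists>T. open T \<and> y \<in> T \<and> T \<subseteq> \<phi> ` U \<and> smooth_on T (f \<circ> ?i)"
        using S sub by blast
    qed
  qed
qed (simp add: smooth_functions_zero_dim)

text \<open>The manifold is covered by two open sets: W, the part of U sent into O', where the
  product is smooth, and the complement of the preimage K of the closed ball, where the bump factor
  makes the function zero.\<close>

lemma cutoff_smooth:
  assumes "n \<noteq> 0" and ch: "(U, \<phi>) \<in> A" and "r > 0" and O': "open O'" "O' \<subseteq> \<phi> ` U" "cball a r \<subseteq> O'"
    and F: "smooth_on O' F"
  shows "(\<lambda>x. if x \<in> U then bump a r (\<phi> x) * F (\<phi> x) else 0) \<in> C"
    (is "?G \<in> C")
proof (rule smooth_functionsI)
  fix V \<psi> assume ch': "(V, \<psi>) \<in> A"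
  let ?i = "inv_into V \<psi>" and ?j = "inv_into U \<phi>"
  define K where "K = ?j ` cball a r"
  define W where "W = U \<inter> \<phi> -` O'"
  have "compact K" unfolding K_def
    by (rule compact_continuous_image[OF continuous_on_subset[of "\<phi> ` U"] compact_cball])
      (use chart_homeomorphism[OF ch] O' in \<open>auto simp: homeomorphism_def simp del: mem_cball\<close>)
  \<comment> \<open>The Hausdorff property enters here; without it the extension by zero could fail
    to be smooth at limit points of K outside U.\<close>
  then have K: "closed K" by (rule compact_imp_closed)
  have W: "open W" unfolding W_def by (rule chart_open_preimage[OF ch O'(1)])
  have KW: "K \<subseteq> W"
  proof
    fix x assume "x \<in> K"
    then obtain y where y: "y \<in> cball a r" "x = ?j y" by (auto simp: K_def)
    then obtain z where "z \<in> U" "y = \<phi> z" using O' by blast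
    then show "x \<in> W" using y O' chart_inv[OF ch] by (auto simp: W_def)
  qed
  have op: "open (\<psi> ` (V \<inter> S))" if "open S" for S
    using chart_open_image[OF ch' assms(1)] that chart_open[OF ch'] by blast
  show "smooth_on (\<psi> ` V) (?G \<circ> ?i)"
  proof (rule smooth_on_local[OF chart_image_open[OF ch' assms(1)]])
    fix y assume "y \<in> \<psi> ` V"
    then obtain q where q: "q \<in> V" "y = \<psi> q" by auto
    show "\<exists>T. open T \<and> y \<in> T \<and> T \<subseteq> \<psi> ` V \<and> smooth_on T (?G \<circ> ?i)"
    proof (cases "q \<in> W")
      case True
      let ?T = "\<psi> ` (V \<inter> W)"
      have "smooth_on ?T (\<phi> \<circ> ?i)"
        by (rule smooth_on_subset[OF op[OF chart_open[OF ch]] op[OF W] _ chart_transition[OF ch' ch]])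
          (auto simp: W_def)
      then have "smooth_on ?T (\<lambda>y. (\<lambda>z. bump a r z * F z) ((\<phi> \<circ> ?i) y))"
        by (rule smooth_on_compose[OF op[OF W] O'(1), rotated])
          (auto simp: W_def chart_inv[OF ch'] intro!: smooth_on_mult O'(1) F
            intro: smooth_on_subset[OF open_UNIV O'(1) _ smooth_on_bump])
      moreover have "(?G \<circ> ?i) y = (\<lambda>z. bump a r z * F z) ((\<phi> \<circ> ?i) y)" if "y \<in> ?T" for y
        using that by (auto simp: W_def chart_inv[OF ch'])
      ultimately have "smooth_on ?T (?G \<circ> ?i)" by (rule smooth_on_eq)
      then show ?thesis using op[OF W] q True by blast
    next
      case False
      let ?T = "\<psi> ` (V \<inter> - K)"
      have oT: "open ?T" using op K by blast
      have "(?G \<circ> ?i) y = 0" if yT: "y \<in> ?T" for y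
      proof -
        obtain x where x: "x \<in> V" "x \<notin> K" "y = \<psi> x" using yT by auto
        have "bump a r (\<phi> x) = 0" if "x \<in> U"
          using that x(2) chart_inv[OF ch that] bump_nonzero_iff[OF \<open>r > 0\<close>, of a "\<phi> x"]
          unfolding K_def by (metis ball_subset_cball imageI subsetD)
        then show ?thesis using x chart_inv[OF ch'] by auto
      qed
      then have "smooth_on ?T (?G \<circ> ?i)"
        by (rule smooth_on_eq[OF smooth_on_const[OF oT]])
      moreover have "y \<in> ?T" using False KW q by blast
      ultimately show ?thesis using oT by blast
    qed
  qed
qed

lemma chart_ball_at:
  assumes "n \<noteq> 0" "open W" "p \<in> W"
  obtains U \<phi> R where "(U, \<phi>) \<in> A" "p \<in> U" "R > 0" "cball (\<phi> p) R \<subseteq> \<phi> ` (U \<inter> W)"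
proof -
  obtain U \<phi> where ch: "(U, \<phi>) \<in> A" "p \<in> U" by (rule chart_at)
  have "open (\<phi> ` (U \<inter> W))" using chart_open_image[OF ch(1) assms(1)] chart_open[OF ch(1)] assms(2) by blast
  moreover have "\<phi> p \<in> \<phi> ` (U \<inter> W)" using ch assms(3) by blast
  ultimately show ?thesis using that ch by (meson open_contains_cball)
qed

lemma bump_function:
  assumes "open W" "p \<in> W"
  obtains b where "b \<in> C" "b p \<noteq> 0" "\<And>x. x \<notin> W \<Longrightarrow> b x = 0"
proof (cases "n = 0")
  case True
  \<comment> \<open>In dimension zero every function is smooth, so an indicator serves as a
    bump.\<close>
  then show ?thesis
    using that[of "indicator W"] assms smooth_functions_zero_dim by simp
next
  case False
  obtain U \<phi> R where ch: "(U, \<phi>) \<in> A" "p \<in> U" and R: "R > 0" "cball (\<phi> p) R \<subseteq> \<phi> ` (U \<inter> W)"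
    by (rule chart_ball_at[OF False assms])
  let ?b = "\<lambda>x. if x \<in> U then bump (\<phi> p) R (\<phi> x) * 1 else 0"
  have op: "open (\<phi> ` U)" using chart_image_open[OF ch(1) False] .
  have "?b \<in> C"
    by (rule cutoff_smooth[OF False ch(1) R(1) op _ _ smooth_on_const[OF op]]) (use R in auto)
  moreover have "?b p \<noteq> 0" using ch R bump_nonzero_iff[of R "\<phi> p" "\<phi> p"] by simp
  moreover have "?b x = 0" if "x \<notin> W" for x
  proof (cases "x \<in> U")
    case True
    then have "\<phi> x \<notin> \<phi> ` (U \<inter> W)" using that chart_inj[OF ch(1)] by (auto simp: inj_on_def)
    then have "\<phi> x \<notin> ball (\<phi> p) R" using R(2) ball_subset_cball by blast
    then show ?thesis using bump_nonzero_iff[OF R(1), of "\<phi> p" "\<phi> x"] by simp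
  qed simp
  ultimately show ?thesis using that by blast
qed

section \<open>Tangent vectors as derivations, and the dimension bound\<close>

lemma tangent_add: "v \<in> T p \<Longrightarrow> f \<in> C \<Longrightarrow> g \<in> C \<Longrightarrow> v (\<lambda>x. f x + g x) = v f + v g"
  unfolding tangent_space_def func_plus by auto

lemma tangent_mult: "v \<in> T p \<Longrightarrow> f \<in> C \<Longrightarrow> g \<in> C \<Longrightarrow> v (\<lambda>x. f x * g x) = f p * v g + g p * v f"
  unfolding tangent_space_def func_times by auto

lemma tangent_cmult: "v \<in> T p \<Longrightarrow> f \<in> C \<Longrightarrow> v (\<lambda>x. c * f x) = c * v f"
  unfolding tangent_space_def scaleR_fun_def by auto

lemma tangent_nonsmooth: "v \<in> T p \<Longrightarrow> f \<notin> C \<Longrightarrow> v f = 0"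
  unfolding tangent_space_def by auto

lemma tangent_const: "v \<in> T p \<Longrightarrow> v (\<lambda>x. c) = 0"
  using tangent_mult[OF _ C_const C_const, of v p 1 1] tangent_cmult[OF _ C_const, of v p c 1] by simp

lemma tangent_diff: "v \<in> T p \<Longrightarrow> f \<in> C \<Longrightarrow> g \<in> C \<Longrightarrow> v (\<lambda>x. f x - g x) = v f - v g"
  using tangent_add[OF _ _ C_mult[OF C_const], of v p f g "-1"] tangent_cmult[of v p g "-1"] by simp

lemma tangent_sum:
  assumes "v \<in> T p" "\<And>i. i \<in> I \<Longrightarrow> f i \<in> C"
  shows "v (\<lambda>x. \<Sum>i\<in>I. f i x) = (\<Sum>i\<in>I. v (f i))"
  using assms(2)
  by (induction I rule: infinite_finite_induct)
    (auto simp: tangent_const[OF assms(1)] tangent_add[OF assms(1)] C_sum)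

lemma tangent_spaceI:
  assumes "\<And>f g. f \<in> C \<Longrightarrow> g \<in> C \<Longrightarrow> v (\<lambda>x. f x + g x) = v f + v g"
    and "\<And>f g. f \<in> C \<Longrightarrow> g \<in> C \<Longrightarrow> v (\<lambda>x. f x * g x) = f p * v g + g p * v f"
    and "\<And>c f. f \<in> C \<Longrightarrow> v (\<lambda>x. c * f x) = c * v f"
    and "\<And>f. f \<notin> C \<Longrightarrow> v f = 0"
  shows "v \<in> T p"
  using assms unfolding tangent_space_def func_plus func_times scaleR_fun_def by auto

lemma subspace_tangent: "subspace (T p)"
proof (rule subspaceI)
  show "0 \<in> T p" by (rule tangent_spaceI) auto
  show "v + w \<in> T p" if "v \<in> T p" "w \<in> T p" for v w
    by (rule tangent_spaceI)
      (simp_all add: tangent_add[OF that(1)] tangent_add[OF that(2)] tangent_mult[OF that(1)]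
        tangent_mult[OF that(2)] tangent_cmult[OF that(1)] tangent_cmult[OF that(2)]
        tangent_nonsmooth[OF that(1)] tangent_nonsmooth[OF that(2)] algebra_simps)
  show "c *\<^sub>R v \<in> T p" if "v \<in> T p" for c v
    by (rule tangent_spaceI)
      (simp_all add: scaleR_fun_def tangent_add[OF that] tangent_mult[OF that] tangent_cmult[OF that]
        tangent_nonsmooth[OF that] algebra_simps)
qed

text \<open>The coordinate derivation at p, set to 0 on functions that are not smooth, as membership
  in the tangent space demands.\<close>

definition partial :: "'m set \<Rightarrow> ('m \<Rightarrow> 'e) \<Rightarrow> 'e \<Rightarrow> 'm \<Rightarrow> 'm tvec"
  where "partial U \<phi> i p f =
    (if f \<in> C then frechet_derivative (f \<circ> inv_into U \<phi>) (at (\<phi> p)) i else 0)"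

lemma partial_tangent:
  assumes "n \<noteq> 0" and ch: "(U, \<phi>) \<in> A" "p \<in> U" shows "partial U \<phi> i p \<in> T p"
proof -
  let ?j = "inv_into U \<phi>"
  have D: "((\<lambda>y. f (?j y)) has_derivative frechet_derivative (f \<circ> ?j) (at (\<phi> p))) (at (\<phi> p))"
    if "f \<in> C" for f
    using smooth_on_has_derivative[OF chart_image_open[OF ch(1) assms(1)] smooth_functionsD[OF that ch(1)]] ch
    by (simp add: o_def)
  show ?thesis
  proof (rule tangent_spaceI)
    fix f g assume f: "f \<in> C" and g: "g \<in> C"
    show "partial U \<phi> i p (\<lambda>x. f x + g x) = partial U \<phi> i p f + partial U \<phi> i p g"
      using frechet_derivative_at[OF has_derivative_add[OF D[OF f] D[OF g]], symmetric] f g C_add[OF f g]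
      by (simp add: partial_def o_def)
    show "partial U \<phi> i p (\<lambda>x. f x * g x) = f p * partial U \<phi> i p g + g p * partial U \<phi> i p f"
      using frechet_derivative_at[OF has_derivative_mult[OF D[OF f] D[OF g]], symmetric] f g C_mult[OF f g]
        chart_inv[OF ch]
      by (simp add: partial_def o_def)
  next
    fix c f assume f: "f \<in> C"
    show "partial U \<phi> i p (\<lambda>x. c * f x) = c * partial U \<phi> i p f"
      using frechet_derivative_at[OF has_derivative_mult_right[OF D[OF f]], of c, symmetric] f C_mult[OF C_const f]
      by (simp add: partial_def o_def)
  qed (simp add: partial_def)
qed

text \<open>With a bump function \<open>b\<close> around \<open>p\<close> the local Hadamard expansion of \<open>f\<close> becomes the global
  identity \<open>b\<^sup>2 f = f(p) b\<^sup>2 + \<Sum>\<^sub>i (b (x\<^sub>i - x\<^sub>i(p))) (b g\<^sub>i)\<close>, to which the derivation \<open>v\<close> applies.\<close>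

lemma tangent_eq_sum_partials:
  assumes "n \<noteq> 0" and ch: "(U, \<phi>) \<in> A" "p \<in> U" and v: "v \<in> T p"
  obtains c where "v = (\<Sum>i\<in>Basis. c i *\<^sub>R partial U \<phi> i p)"
proof -
  let ?j = "inv_into U \<phi>" and ?a = "\<phi> p"
  have op: "open (\<phi> ` U)" using chart_image_open[OF ch(1) assms(1)] .
  obtain R where R: "R > 0" "ball ?a R \<subseteq> \<phi> ` U"
    using op ch(2) open_contains_ball by (metis imageI)
  \<comment> \<open>Half the radius: the closed ball, on which the bump lives, must lie inside the
    open ball on which the Hadamard expansion holds.\<close>
  define r where "r = R / 2"
  have r: "r > 0" "cball ?a r \<subseteq> ball ?a R" using R by (auto simp: r_def)
  define cut where "cut F = (\<lambda>x. if x \<in> U then bump ?a r (\<phi> x) * F (\<phi> x) else 0)" for F :: "'e \<Rightarrow> real"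
  have cut: "cut F \<in> C" if "smooth_on (ball ?a R) F" for F
    unfolding cut_def by (rule cutoff_smooth[OF assms(1) ch(1) r(1) open_ball R(2) r(2) that])
  define b where "b = cut (\<lambda>_. 1)"
  define Xi where "Xi i = cut (\<lambda>y. y \<bullet> i + - (?a \<bullet> i))" for i
  have bC: "b \<in> C" unfolding b_def by (intro cut smooth_on_const open_ball)
  have XC: "Xi i \<in> C" for i
    unfolding Xi_def by (intro cut smooth_on_add smooth_on_inner_left smooth_on_ident smooth_on_const open_ball)
  have bp: "b p = bump ?a r ?a" "b p \<noteq> 0"
    using ch(2) bump_nonzero_iff[OF r(1), of ?a ?a] r(1) by (simp_all add: b_def cut_def)
  have Xp: "Xi i p = 0" for i by (simp add: Xi_def cut_def)
  have main: "v f = (\<Sum>i\<in>Basis. (v (Xi i) / b p) * partial U \<phi> i p f)" if f: "f \<in> C" for f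
  proof -
    have sm: "smooth_on (ball ?a R) (f \<circ> ?j)"
      by (rule smooth_on_subset[OF op open_ball R(2) smooth_functionsD[OF f ch(1)]])
    obtain g where g: "\<And>i. smooth_on (ball ?a R) (g i)"
      "\<And>i. g i ?a = frechet_derivative (f \<circ> ?j) (at ?a) i"
      "\<And>x. x \<in> ball ?a R \<Longrightarrow> (f \<circ> ?j) x = (f \<circ> ?j) ?a + (\<Sum>i\<in>Basis. ((x - ?a) \<bullet> i) * g i x)"
      using hadamard[OF sm R(1)] by blast
    have GC: "cut (g i) \<in> C" for i by (rule cut[OF g(1)])
    have Gp: "cut (g i) p = b p * partial U \<phi> i p f" for i
      using f ch(2) by (simp add: cut_def bp g(2) partial_def)
    have "b x * b x * f x = f p * (b x * b x) + (\<Sum>i\<in>Basis. Xi i x * cut (g i) x)" for x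
    proof (cases "x \<in> U \<and> \<phi> x \<in> ball ?a r")
      case True
      then have "\<phi> x \<in> ball ?a R" using r(2) ball_subset_cball[of ?a r] by blast
      from g(3)[OF this] have fx: "f x = f p + (\<Sum>i\<in>Basis. ((\<phi> x - ?a) \<bullet> i) * g i (\<phi> x))"
        using True chart_inv[OF ch(1)] ch(2) by simp
      have bx: "bump ?a r (\<phi> x) = b x" using True by (simp add: b_def cut_def)
      have "(\<Sum>i\<in>Basis. Xi i x * cut (g i) x) = (\<Sum>i\<in>Basis. (b x * b x) * (((\<phi> x - ?a) \<bullet> i) * g i (\<phi> x)))"
        using True by (intro sum.cong) (auto simp: Xi_def cut_def bx inner_diff_left)
      also have "\<dots> = b x * b x * (f x - f p)"
        by (simp add: fx sum_distrib_left)
      finally show ?thesis by (simp add: algebra_simps)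
    next
      case False
      then have "b x = 0" "Xi i x = 0" for i
        using bump_nonzero_iff[OF r(1), of ?a "\<phi> x"] by (auto simp: b_def Xi_def cut_def)
      then show ?thesis by simp
    qed
    then have "v (\<lambda>x. b x * b x * f x) = v (\<lambda>x. f p * (b x * b x) + (\<Sum>i\<in>Basis. Xi i x * cut (g i) x))"
      by simp
    \<comment> \<open>By the Leibniz rule the terms with v b agree on both sides and cancel. As
      \<open>Xi i\<close> vanishes at p, each product contributes only the summand with v
      (\<open>Xi i\<close>).\<close>
    then have "b p * b p * v f + f p * (b p * v b + b p * v b) =
        f p * (b p * v b + b p * v b) + (\<Sum>i\<in>Basis. cut (g i) p * v (Xi i))"
      by (simp add: tangent_mult[OF v] tangent_add[OF v] tangent_cmult[OF v] tangent_sum[OF v] tangent_const[OF v]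
          C_mult C_sum C_const bC XC GC f Xp)
    then have "b p * b p * v f = (\<Sum>i\<in>Basis. (b p * partial U \<phi> i p f) * v (Xi i))"
      by (simp add: Gp)
    also have "\<dots> = b p * b p * (\<Sum>i\<in>Basis. (v (Xi i) / b p) * partial U \<phi> i p f)"
      using bp(2) by (simp add: sum_distrib_left field_simps)
    finally show ?thesis using bp(2) by simp
  qed
  have sum_apply: "(\<Sum>i\<in>Basis. c i *\<^sub>R w i) f = (\<Sum>i\<in>Basis. c i * (w i f :: real))"
    for c and w :: "'e \<Rightarrow> 'm tvec" and f
    by (induction rule: infinite_finite_induct) (auto simp: scaleR_fun_def)
  have "v = (\<Sum>i\<in>Basis. (v (Xi i) / b p) *\<^sub>R partial U \<phi> i p)"
  proof
    show "v f = (\<Sum>i\<in>Basis. (v (Xi i) / b p) *\<^sub>R partial U \<phi> i p) f" for f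
      using main[of f] tangent_nonsmooth[OF v, of f]
      by (cases "f \<in> C") (simp_all add: sum_apply partial_def)
  qed
  then show ?thesis by (rule that)
qed

text \<open>The indicator b of p is smooth and idempotent, so v b = 2 v b and v b = 0. Since b f =
  f(p) b, applying v gives v f = 0.\<close>

lemma tangent_zero_dim:
  assumes "n = 0" "v \<in> T p" shows "v = 0"
proof
  fix f :: "'m \<Rightarrow> real"
  let ?b = "indicator {p} :: 'm \<Rightarrow> real"
  have C: "f \<in> C" for f using smooth_functions_zero_dim[OF assms(1)] by simp
  have "v ?b = 0"
    using tangent_mult[OF assms(2) C C, of ?b ?b] by (simp flip: indicator_inter_arith)
  moreover have "(\<lambda>x. ?b x * f x) = (\<lambda>x. f p * ?b x)"
    by (auto simp: indicator_def)
  ultimately show "v f = 0 f"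
    using tangent_mult[OF assms(2) C C, of ?b f] tangent_cmult[OF assms(2) C, of "f p" ?b] by simp
qed

text \<open>This bounds the dimension from above; n independent vectors are supplied later by the
  nonvanishing of the volume form.\<close>

lemma tangent_finite_span: obtains B where "finite B" "card B \<le> n" "T p \<subseteq> span B"
proof (cases "n = 0")
  case True
  then show ?thesis using that[of "{}"] tangent_zero_dim by auto
next
  case False
  obtain U \<phi> where ch: "(U, \<phi>) \<in> A" "p \<in> U" by (rule chart_at)
  let ?B = "(\<lambda>i. partial U \<phi> i p) ` Basis"
  have "card ?B \<le> n" using card_image_le[OF finite_Basis] dim_eq[OF False] by simp
  moreover have "T p \<subseteq> span ?B"
  proof
    fix v assume "v \<in> T p"
    from tangent_eq_sum_partials[OF False ch this]
    obtain c where v: "v = (\<Sum>i\<in>Basis. c i *\<^sub>R partial U \<phi> i p)" .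
    show "v \<in> span ?B" unfolding v by (intro span_sum span_scale span_base) auto
  qed
  ultimately show ?thesis using that[of ?B] by simp
qed

section \<open>The module of vector fields, the Lie bracket and extension of vectors\<close>

lemma VF_tangent: "Y \<in> VF \<Longrightarrow> Y p \<in> T p"
  by (simp add: vector_fields_def)

lemma VF_smooth: "Y \<in> VF \<Longrightarrow> f \<in> C \<Longrightarrow> (\<lambda>p. Y p f) \<in> C"
  by (simp add: vector_fields_def)

lemma VF_I: "(\<And>p. Y p \<in> T p) \<Longrightarrow> (\<And>f. f \<in> C \<Longrightarrow> (\<lambda>p. Y p f) \<in> C) \<Longrightarrow> Y \<in> VF"
  by (simp add: vector_fields_def)

lemma VF_zero: "(\<lambda>p. 0) \<in> VF"
  by (rule VF_I) (auto simp: subspace_0[OF subspace_tangent] C_const)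

lemma VF_add: "X \<in> VF \<Longrightarrow> Y \<in> VF \<Longrightarrow> (\<lambda>p. X p + Y p) \<in> VF"
  by (rule VF_I) (auto simp: subspace_add[OF subspace_tangent] VF_tangent intro: C_add VF_smooth)

lemma VF_scale: "f \<in> C \<Longrightarrow> Y \<in> VF \<Longrightarrow> (\<lambda>p. f p *\<^sub>R Y p) \<in> VF"
  by (rule VF_I, simp add: subspace_scale[OF subspace_tangent] VF_tangent)
    (auto simp: scaleR_fun_def intro: C_mult VF_smooth)

lemma VF_sum: "(\<And>i. i \<in> I \<Longrightarrow> Y i \<in> VF) \<Longrightarrow> (\<lambda>p. \<Sum>i\<in>I. Y i p) \<in> VF"
  by (induction I rule: infinite_finite_induct) (auto intro: VF_zero VF_add)

lemma VF_bracket: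
  assumes X: "X \<in> VF" and Y: "Y \<in> VF" shows "lie_bracket X Y \<in> VF"
proof (rule VF_I)
  note tX = VF_tangent[OF X] and tY = VF_tangent[OF Y]
  show "(\<lambda>p. lie_bracket X Y p f) \<in> C" if "f \<in> C" for f
    unfolding lie_bracket_def by (intro C_diff VF_smooth[OF X] VF_smooth[OF Y] that)
  show "lie_bracket X Y p \<in> T p" for p
  proof (rule tangent_spaceI)
    fix f g assume f: "f \<in> C" and g: "g \<in> C"
    note Xf = VF_smooth[OF X f] and Xg = VF_smooth[OF X g] and Yf = VF_smooth[OF Y f] and Yg = VF_smooth[OF Y g]
    show "lie_bracket X Y p (\<lambda>x. f x + g x) = lie_bracket X Y p f + lie_bracket X Y p g"
      unfolding lie_bracket_def tangent_add[OF tX f g] tangent_add[OF tY f g]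
        tangent_add[OF tX Yf Yg] tangent_add[OF tY Xf Xg] by simp
    show "lie_bracket X Y p (\<lambda>x. f x * g x) = f p * lie_bracket X Y p g + g p * lie_bracket X Y p f"
      unfolding lie_bracket_def tangent_mult[OF tX f g] tangent_mult[OF tY f g]
        tangent_add[OF tX C_mult[OF f Yg] C_mult[OF g Yf]] tangent_add[OF tY C_mult[OF f Xg] C_mult[OF g Xf]]
        tangent_mult[OF tX f Yg] tangent_mult[OF tX g Yf] tangent_mult[OF tY f Xg] tangent_mult[OF tY g Xf]
      by (simp add: algebra_simps)
  next
    fix c f assume f: "f \<in> C"
    show "lie_bracket X Y p (\<lambda>x. c * f x) = c * lie_bracket X Y p f"
      unfolding lie_bracket_def tangent_cmult[OF tX f] tangent_cmult[OF tY f]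
        tangent_cmult[OF tX VF_smooth[OF Y f]] tangent_cmult[OF tY VF_smooth[OF X f]]
      by (simp add: algebra_simps)
  next
    fix f assume "f \<notin> C"
    then show "lie_bracket X Y p f = 0"
      by (simp add: lie_bracket_def tangent_nonsmooth[OF tX] tangent_nonsmooth[OF tY]
          tangent_const[OF tX] tangent_const[OF tY])
  qed
qed

text \<open>The coordinate fields, cut off by a bump and extended by zero, are the global fields
  \<open>E i\<close>. Dividing the coefficients of v by the value of the bump at p compensates the
  cut-off there.\<close>

lemma tangent_extends:
  assumes v: "v \<in> T p" obtains Y where "Y \<in> VF" "Y p = v"
proof (cases "n = 0")
  case True
  then show ?thesis using that[OF VF_zero] tangent_zero_dim[OF _ v] by simp
next
  case False
  obtain U \<phi> R where ch: "(U, \<phi>) \<in> A" "p \<in> U" and R: "R > 0" "cball (\<phi> p) R \<subseteq> \<phi> ` (U \<inter> UNIV)"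
    by (rule chart_ball_at[OF False open_UNIV UNIV_I])
  have op: "open (\<phi> ` U)" using chart_image_open[OF ch(1) False] .
  define E where "E i q = (if q \<in> U then bump (\<phi> p) R (\<phi> q) *\<^sub>R partial U \<phi> i q else 0)" for i q
  have E: "E i \<in> VF" for i
  proof (rule VF_I)
    show "E i q \<in> T q" for q
      using subspace_scale[OF subspace_tangent partial_tangent[OF False ch(1)]] subspace_0[OF subspace_tangent]
      by (auto simp: E_def)
    fix f assume f: "f \<in> C"
    have "(\<lambda>q. E i q f) = (\<lambda>q. if q \<in> U then bump (\<phi> p) R (\<phi> q) *
        frechet_derivative (f \<circ> inv_into U \<phi>) (at (\<phi> q)) i else 0)"
      using f by (auto simp: E_def scaleR_fun_def partial_def)
    also have "\<dots> \<in> C"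
      by (rule cutoff_smooth[OF False ch(1) R(1) op _ _ smooth_on_frechet_derivative[OF op]])
        (use R(2) smooth_functionsD[OF f ch(1)] in auto)
    finally show "(\<lambda>q. E i q f) \<in> C" .
  qed
  obtain c where c: "v = (\<Sum>i\<in>Basis. c i *\<^sub>R partial U \<phi> i p)"
    by (rule tangent_eq_sum_partials[OF False ch v])
  let ?\<beta> = "bump (\<phi> p) R (\<phi> p)"
  have "?\<beta> \<noteq> 0" using bump_nonzero_iff[OF R(1), of "\<phi> p" "\<phi> p"] R(1) by simp
  then have "v = (\<Sum>i\<in>Basis. (c i / ?\<beta>) *\<^sub>R E i p)"
    using ch(2) by (simp add: c E_def)
  moreover have "(\<lambda>q. \<Sum>i\<in>Basis. (c i / ?\<beta>) *\<^sub>R E i q) \<in> VF"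
    by (intro VF_sum VF_scale[OF C_const] E)
  ultimately show ?thesis using that by blast
qed

end

section \<open>Alternating forms in top degree\<close>

lemma lists_list_update: "vs \<in> lists V \<Longrightarrow> u \<in> V \<Longrightarrow> vs[i := u] \<in> lists V"
  using set_update_subset_insert[of vs i u] by (auto simp: in_lists_conv_set)

locale alternating_form =
  fixes V :: "'v::real_vector set" and k :: nat and \<omega> :: "'v list \<Rightarrow> real"
  assumes subspace_V: "subspace V" and alternating: "alternating_multilinear V k \<omega>"
begin

lemmas V_update = lists_list_update[where V = V]

lemma form_lin:
  "vs \<in> lists V \<Longrightarrow> length vs = k \<Longrightarrow> i < k \<Longrightarrow> u \<in> V \<Longrightarrow> w \<in> V \<Longrightarrow>
    \<omega> (vs[i := a *\<^sub>R u + b *\<^sub>R w]) = a * \<omega> (vs[i := u]) + b * \<omega> (vs[i := w])"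
  using alternating unfolding alternating_multilinear_def by blast

lemma form_not_distinct: "vs \<in> lists V \<Longrightarrow> length vs = k \<Longrightarrow> \<not> distinct vs \<Longrightarrow> \<omega> vs = 0"
  using alternating unfolding alternating_multilinear_def by blast

lemma form_add:
  "vs \<in> lists V \<Longrightarrow> length vs = k \<Longrightarrow> i < k \<Longrightarrow> u \<in> V \<Longrightarrow> w \<in> V \<Longrightarrow>
    \<omega> (vs[i := u + w]) = \<omega> (vs[i := u]) + \<omega> (vs[i := w])"
  using form_lin[of vs i u w 1 1] by simp

lemma form_scale:
  "vs \<in> lists V \<Longrightarrow> length vs = k \<Longrightarrow> i < k \<Longrightarrow> u \<in> V \<Longrightarrow>
    \<omega> (vs[i := a *\<^sub>R u]) = a * \<omega> (vs[i := u])"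
  using form_lin[of vs i u u a 0] by simp

lemma form_zero: "vs \<in> lists V \<Longrightarrow> length vs = k \<Longrightarrow> i < k \<Longrightarrow> \<omega> (vs[i := 0]) = 0"
  using form_scale[of vs i 0 0] subspace_0[OF subspace_V] by simp

lemma form_sum:
  assumes "vs \<in> lists V" "length vs = k" "i < k" "\<And>j. j \<in> J \<Longrightarrow> u j \<in> V"
  shows "\<omega> (vs[i := \<Sum>j\<in>J. c j *\<^sub>R u j]) = (\<Sum>j\<in>J. c j * \<omega> (vs[i := u j]))"
  using assms(4)
proof (induction J rule: infinite_finite_induct)
  case (insert x J)
  have "(\<Sum>j\<in>J. c j *\<^sub>R u j) \<in> V"
    by (intro subspace_sum[OF subspace_V] subspace_scale[OF subspace_V]) (use insert in auto)
  then show ?case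
    using insert assms form_add[of vs i "c x *\<^sub>R u x"] subspace_scale[OF subspace_V]
    by (simp add: form_scale)
qed (use form_zero assms in auto)

lemma form_repeat:
  assumes "vs \<in> lists V" "length vs = k" "i < k" "j < k" "i \<noteq> j"
  shows "\<omega> (vs[i := vs ! j]) = 0"
proof (rule form_not_distinct)
  show "\<not> distinct (vs[i := vs ! j])"
    using assms nth_eq_iff_index_eq[of "vs[i := vs ! j]" i j] by auto
qed (use assms V_update[of vs "vs ! j" i] in auto)

text \<open>Polarization: the form vanishes when slots i and j both hold u + w, and expanding leaves
  the two mixed terms.\<close>

lemma form_swap:
  assumes vs: "vs \<in> lists V" "length vs = k" "i < k" "j < k" "i \<noteq> j" and uw: "u \<in> V" "w \<in> V"
  shows "\<omega> (vs[i := u, j := w]) = - \<omega> (vs[i := w, j := u])"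
proof -
  have rep: "\<omega> (vs[i := x, j := x]) = 0" if "x \<in> V" for x
    using form_repeat[of "vs[i := x]" j i] vs that V_update by simp
  have add1: "\<omega> (vs[i := x + y, j := z]) = \<omega> (vs[i := x, j := z]) + \<omega> (vs[i := y, j := z])"
    if "x \<in> V" "y \<in> V" "z \<in> V" for x y z
    using form_add[of "vs[j := z]" i x y] that vs V_update by (simp add: list_update_swap)
  have add2: "\<omega> (vs[i := z, j := x + y]) = \<omega> (vs[i := z, j := x]) + \<omega> (vs[i := z, j := y])"
    if "x \<in> V" "y \<in> V" "z \<in> V" for x y z
    using form_add[of "vs[i := z]" j x y] that vs V_update by simp
  have "0 = \<omega> (vs[i := u + w, j := u + w])"
    using rep subspace_add[OF subspace_V] uw by simp
  also have "\<dots> = \<omega> (vs[i := u, j := u]) + \<omega> (vs[i := u, j := w]) +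
      (\<omega> (vs[i := w, j := u]) + \<omega> (vs[i := w, j := w]))"
    using uw by (simp add: add1 add2 subspace_add[OF subspace_V])
  finally show ?thesis using rep uw by simp
qed

text \<open>If an entry were a combination of the others, substituting it would turn the value into
  a sum of terms each with a repeated entry.\<close>

lemma form_nonzero_independent:
  assumes vs: "vs \<in> lists V" "length vs = k" and nz: "\<omega> vs \<noteq> 0"
  shows "distinct vs" "independent (set vs)"
proof -
  show "distinct vs" using form_not_distinct vs nz by blast
  show "independent (set vs)"
  proof
    assume "dependent (set vs)"
    then obtain i where i: "i < k" "vs ! i \<in> span (set vs - {vs ! i})"
      using vs(2) by (auto simp: dependent_def in_set_conv_nth)
    then obtain c where c: "vs ! i = (\<Sum>u\<in>set vs - {vs ! i}. c u *\<^sub>R u)"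
      by (auto simp: span_finite)
    have "\<omega> vs = \<omega> (vs[i := vs ! i])" by simp
    also have "\<dots> = \<omega> (vs[i := \<Sum>u\<in>set vs - {vs ! i}. c u *\<^sub>R u])" using c by simp
    also have "\<dots> = (\<Sum>u\<in>set vs - {vs ! i}. c u * \<omega> (vs[i := u]))"
      by (rule form_sum) (use vs i in auto)
    also have "\<dots> = 0"
    proof (rule sum.neutral, rule ballI)
      fix u assume "u \<in> set vs - {vs ! i}"
      then obtain j where "j < k" "u = vs ! j" "j \<noteq> i" using vs(2) by (auto simp: in_set_conv_nth)
      then show "c u * \<omega> (vs[i := u]) = 0" using form_repeat[OF vs i(1)] by simp
    qed
    finally show False using nz by simp
  qed
qed

end

text \<open>The bound dim V \<le> k is expressed by a finite spanning set, since tangent spaces are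
  subsets of an infinite-dimensional function space.\<close>

locale top_form = alternating_form +
  assumes finite_span: "\<exists>B. finite B \<and> card B \<le> k \<and> V \<subseteq> span B"
begin

text \<open>A vector outside the span would give k + 1 independent vectors inside the span of at
  most k.\<close>

lemma form_nonzero_span:
  assumes vs: "vs \<in> lists V" "length vs = k" and nz: "\<omega> vs \<noteq> 0"
  shows "V \<subseteq> span (set vs)"
proof
  fix x assume x: "x \<in> V"
  note ind = form_nonzero_independent[OF vs nz]
  obtain B where B: "finite B" "card B \<le> k" "V \<subseteq> span B" using finite_span by blast
  show "x \<in> span (set vs)"
  proof (rule ccontr)
    assume notin: "x \<notin> span (set vs)"
    then have "independent (insert x (set vs))" using ind(2) by (simp add: independent_insertI)
    moreover have "insert x (set vs) \<subseteq> span B" using x vs B by auto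
    ultimately have "card (insert x (set vs)) \<le> card B" using independent_span_bound[OF B(1)] by blast
    moreover have "x \<notin> set vs" using notin span_base by blast
    ultimately show False using ind(1) vs(2) B(2) by (simp add: distinct_card)
  qed
qed

text \<open>The entries of vs form a basis. When x, expanded in it, is put into slot i, every term
  but the i-th repeats an entry, so the value is the i-th coefficient of x times \<omega>
  vs.\<close>

lemma cramer:
  assumes vs: "vs \<in> lists V" "length vs = k" and nz: "\<omega> vs \<noteq> 0" and x: "x \<in> V"
  shows "\<omega> vs *\<^sub>R x = (\<Sum>i<k. \<omega> (vs[i := x]) *\<^sub>R (vs ! i))"
proof -
  have "x \<in> span (set vs)" using form_nonzero_span[OF vs nz] x by blast
  then obtain c where c: "x = (\<Sum>u\<in>set vs. c u *\<^sub>R u)" by (auto simp: span_finite)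
  have bij: "bij_betw ((!) vs) {..<k} (set vs)"
    using bij_betw_nth[OF form_nonzero_independent(1)[OF vs nz]] vs(2) by simp
  have x_eq: "x = (\<Sum>j<k. c (vs ! j) *\<^sub>R (vs ! j))"
    unfolding sum.reindex_bij_betw[OF bij, of "\<lambda>u. c u *\<^sub>R u"] using c .
  have "\<omega> (vs[i := x]) = c (vs ! i) * \<omega> vs" if i: "i < k" for i
  proof -
    have "\<omega> (vs[i := x]) = (\<Sum>j<k. c (vs ! j) * \<omega> (vs[i := vs ! j]))"
      by (subst x_eq, rule form_sum) (use vs i in auto)
    also have "\<dots> = (\<Sum>j<k. if j = i then c (vs ! i) * \<omega> vs else 0)"
      by (rule sum.cong) (use form_repeat[OF vs i] in auto)
    finally show ?thesis using i by simp
  qed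
  then have "(\<Sum>i<k. \<omega> (vs[i := x]) *\<^sub>R (vs ! i)) = (\<Sum>i<k. \<omega> vs *\<^sub>R (c (vs ! i) *\<^sub>R (vs ! i)))"
    by (intro sum.cong) (auto simp: mult.commute)
  also have "\<dots> = \<omega> vs *\<^sub>R x" by (subst x_eq) (rule scaleR_sum_right[symmetric])
  finally show ?thesis by simp
qed

text \<open>Steinitz exchange: the entries of a list on which the form does not vanish can be replaced
  one after the other by those of the basis \<open>E\<close>.\<close>

lemma form_nonzero_on_basis:
  assumes E: "E \<in> lists V" "length E = k" "distinct E" "independent (set E)"
    and vs: "vs \<in> lists V" "length vs = k" "\<omega> vs \<noteq> 0"
  shows "\<omega> E \<noteq> 0"
proof -
  have "\<exists>ws\<in>lists V. length ws = k \<and> \<omega> ws \<noteq> 0 \<and> take m ws = take m E" if "m \<le> k" for m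
    using that
  proof (induction m)
    case 0
    then show ?case using vs by auto
  next
    case (Suc m)
    then obtain ws where ws: "ws \<in> lists V" "length ws = k" and nz: "\<omega> ws \<noteq> 0"
      and tk: "take m ws = take m E" by auto
    have m: "m < k" using Suc.prems by simp
    let ?x = "E ! m"
    have xV: "?x \<in> V" using E m by auto
    \<comment> \<open>If every slot from m on failed, Cramer's rule would express
      \<open>E ! m\<close> through slots below m, that is, through earlier entries of E, against
      independence.\<close>
    have "\<exists>i. m \<le> i \<and> i < k \<and> \<omega> (ws[i := ?x]) \<noteq> 0"
    proof (rule ccontr)
      assume no: "\<not> ?thesis"
      have "\<omega> (ws[i := ?x]) *\<^sub>R (ws ! i) \<in> span (set (take m E))" if "i < k" for i
      proof (cases "i < m")
        case True
        then have "ws ! i = take m E ! i" using tk by (metis nth_take)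
        then have "ws ! i \<in> set (take m E)" using True m E(2) nth_mem[of i "take m E"] by simp
        then show ?thesis by (intro span_scale span_base)
      next
        case False
        then have "\<omega> (ws[i := ?x]) = 0" using no that by auto
        then show ?thesis by (simp add: span_zero)
      qed
      then have "\<omega> ws *\<^sub>R ?x \<in> span (set (take m E))"
        unfolding cramer[OF ws nz xV] by (intro span_sum) auto
      then have "inverse (\<omega> ws) *\<^sub>R \<omega> ws *\<^sub>R ?x \<in> span (set (take m E))" by (rule span_scale)
      then have "?x \<in> span (set (take m E))" using nz by simp
      moreover have "set (take m E) \<subseteq> set E - {?x}"
        using E(2,3) m by (auto simp: set_conv_nth nth_eq_iff_index_eq)
      ultimately have "?x \<in> span (set E - {?x})" using span_mono by blast
      then show False using E(2,4) m unfolding dependent_def by (metis nth_mem)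
    qed
    then obtain i where i: "m \<le> i" "i < k" "\<omega> (ws[i := ?x]) \<noteq> 0" by blast
    \<comment> \<open>The vector fits into slot i but is wanted in slot m. Exchanging the two
      entries changes only the sign and leaves the first m slots alone.\<close>
    let ?ws = "ws[i := ws ! m, m := ?x]"
    have wmV: "ws ! m \<in> V" using ws m by auto
    have "\<omega> ?ws \<noteq> 0"
    proof (cases "i = m")
      case False
      have "ws[i := ?x, m := ws ! m] = ws[i := ?x]"
        using False by (metis list_update_id list_update_swap)
      then show ?thesis using form_swap[OF ws i(2) m False wmV xV] i(3) by simp
    qed (use i in simp)
    moreover have "take (Suc m) ?ws = take (Suc m) E"
      using m i ws(2) E(2) tk by (simp add: take_Suc_conv_app_nth)
    ultimately show ?case using ws V_update wmV xV by (intro bexI[of _ ?ws]) auto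
  qed
  from this[of k] show ?thesis using E(2) by auto
qed

text \<open>The difference of the two sides is again a top form in vs, and it vanishes on E. As E is
  a basis, \<open>form_nonzero_on_basis\<close> forbids a nonzero value anywhere.\<close>

lemma top_forms_proportional:
  assumes \<eta>: "alternating_multilinear V k \<eta>"
    and E: "E \<in> lists V" "length E = k" "\<omega> E \<noteq> 0" and vs: "vs \<in> lists V" "length vs = k"
  shows "\<eta> vs * \<omega> E = \<omega> vs * \<eta> E"
proof -
  let ?\<tau> = "\<lambda>vs. \<eta> vs * \<omega> E - \<omega> vs * \<eta> E"
  have "alternating_multilinear V k ?\<tau>"
    using \<eta> alternating unfolding alternating_multilinear_def by (simp add: algebra_simps)
  then interpret \<tau>: top_form V k ?\<tau>
    using subspace_V finite_span by unfold_locales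
  show ?thesis
    using \<tau>.form_nonzero_on_basis[OF E(1,2) form_nonzero_independent[OF E] vs] by auto
qed

end

section \<open>Volume forms and the divergence\<close>

context manifold begin

text \<open>Non-smooth f are included because derivations are 0 on them. Identities between
  brackets, which are equalities of functions on all f, can thus be proved without a case
  distinction.\<close>

lemma VF_apply_smooth: "Y \<in> VF \<Longrightarrow> (\<lambda>p. Y p f) \<in> C"
  using VF_smooth[of Y f] tangent_nonsmooth[OF VF_tangent, of Y f] by (cases "f \<in> C") (auto simp: C_const)

definition extension :: "'m \<Rightarrow> 'm tvec \<Rightarrow> 'm vfield"
  where "extension p v = (SOME Y. Y \<in> VF \<and> Y p = v)"

lemma extension:
  assumes "v \<in> T p" shows "extension p v \<in> VF" "extension p v p = v"
proof -
  have "\<exists>Y. Y \<in> VF \<and> Y p = v" by (rule tangent_extends[OF assms]) blast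
  from someI_ex[OF this] show "extension p v \<in> VF" "extension p v p = v"
    by (simp_all add: extension_def)
qed

lemma bracket_add:
  assumes "Z \<in> VF" "U \<in> VF" "W \<in> VF"
  shows "lie_bracket Z (\<lambda>p. U p + W p) = (\<lambda>p. lie_bracket Z U p + lie_bracket Z W p)"
proof (intro ext)
  show "lie_bracket Z (\<lambda>p. U p + W p) p f = (lie_bracket Z U p + lie_bracket Z W p) f" for p f
    by (simp add: lie_bracket_def tangent_add[OF VF_tangent[OF assms(1)] VF_apply_smooth[OF assms(2)]
          VF_apply_smooth[OF assms(3)]])
qed

lemma bracket_scale:
  assumes "Z \<in> VF" "U \<in> VF" "f \<in> C"
  shows "lie_bracket Z (\<lambda>p. f p *\<^sub>R U p) = (\<lambda>p. Z p f *\<^sub>R U p + f p *\<^sub>R lie_bracket Z U p)"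
proof (intro ext)
  show "lie_bracket Z (\<lambda>p. f p *\<^sub>R U p) p u = (Z p f *\<^sub>R U p + f p *\<^sub>R lie_bracket Z U p) u" for p u
    by (simp add: lie_bracket_def scaleR_fun_def algebra_simps
        tangent_mult[OF VF_tangent[OF assms(1)] assms(3) VF_apply_smooth[OF assms(2)]])
qed

end

locale volume_manifold = manifold n A
  for n :: nat and A :: "('m::{t2_space,second_countable_topology}, 'e::euclidean_space) chart set" +
  fixes \<Omega> :: "'m form"
  assumes volume: "volume_form n A \<Omega>"
begin

abbreviation "FA \<equiv> form_apply \<Omega>"

sublocale \<Omega>: top_form "T p" n "\<Omega> p" for p
proof
  show "subspace (T p)" by (rule subspace_tangent)
  show "alternating_multilinear (T p) n (\<Omega> p)"
    using volume by (simp add: volume_form_def differential_form_def)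
  show "\<exists>B. finite B \<and> card B \<le> n \<and> T p \<subseteq> span B"
    by (rule tangent_finite_span) blast
qed

lemma FA_smooth: "Ys \<in> lists VF \<Longrightarrow> length Ys = n \<Longrightarrow> FA Ys \<in> C"
  using volume by (simp add: volume_form_def differential_form_def)

lemma FA_update_smooth: "Ys \<in> lists VF \<Longrightarrow> length Ys = n \<Longrightarrow> U \<in> VF \<Longrightarrow> FA (Ys[i := U]) \<in> C"
  by (rule FA_smooth[OF lists_list_update]) simp_all

lemma fields_at: "Ys \<in> lists VF \<Longrightarrow> map (\<lambda>Y. Y p) Ys \<in> lists (T p)"
  using VF_tangent by auto

lemma FA_update: "FA (Ys[i := U]) p = \<Omega> p ((map (\<lambda>Y. Y p) Ys)[i := U p])"
  by (simp add: form_apply_def map_update)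

lemma FA_add:
  "Ys \<in> lists VF \<Longrightarrow> length Ys = n \<Longrightarrow> i < n \<Longrightarrow> U \<in> VF \<Longrightarrow> W \<in> VF \<Longrightarrow>
    FA (Ys[i := \<lambda>p. U p + W p]) p = FA (Ys[i := U]) p + FA (Ys[i := W]) p"
  by (simp only: FA_update) (rule \<Omega>.form_add, simp_all only: fields_at length_map VF_tangent)

lemma FA_scale:
  "Ys \<in> lists VF \<Longrightarrow> length Ys = n \<Longrightarrow> i < n \<Longrightarrow> U \<in> VF \<Longrightarrow>
    FA (Ys[i := \<lambda>p. f p *\<^sub>R U p]) p = f p * FA (Ys[i := U]) p"
  by (simp only: FA_update) (rule \<Omega>.form_scale, simp_all only: fields_at length_map VF_tangent)

text \<open>The frame is required at p only, but its members are global fields; away from p,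
  \<open>FA Es\<close> serves as a factor that absorbs the points where it degenerates.\<close>

lemma frame_at: obtains Es where "Es \<in> lists VF" "length Es = n" "FA Es p \<noteq> 0"
proof -
  obtain vs where vs: "vs \<in> lists (T p)" "length vs = n" "\<Omega> p vs \<noteq> 0"
    using volume unfolding volume_form_def by blast
  let ?ext = "extension p"
  have "map (\<lambda>Y. Y p) (map ?ext vs) = vs"
    using vs(1) extension by (simp add: map_idI in_lists_conv_set)
  then have "FA (map ?ext vs) p \<noteq> 0" using vs(3) by (simp add: form_apply_def)
  moreover have "map ?ext vs \<in> lists VF" using vs(1) extension by auto
  ultimately show ?thesis using that vs(2) by simp
qed

lemma nth_VF: "Ys \<in> lists VF \<Longrightarrow> length Ys = n \<Longrightarrow> i < n \<Longrightarrow> Ys ! i \<in> VF"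
  by auto

lemma FA_cramer:
  assumes "Ys \<in> lists VF" "length Ys = n" "FA Ys p \<noteq> 0" "U \<in> VF"
  shows "FA Ys p *\<^sub>R U p = (\<Sum>i<n. FA (Ys[i := U]) p *\<^sub>R (Ys ! i) p)"
  using \<Omega>.cramer[OF fields_at[OF assms(1)], where x="U p" and p=p] assms(2,3) VF_tangent[OF assms(4)]
  by (simp add: form_apply_def map_update)

context
  fixes Z :: "'m vfield"
  assumes Z: "Z \<in> VF"
begin

abbreviation "LD \<equiv> lie_derivative_form Z \<Omega>"

section \<open>Tensoriality of the Lie derivative of the volume form, and the divergence\<close>

lemma LD_smooth:
  assumes "Ys \<in> lists VF" "length Ys = n" shows "LD Ys \<in> C"
  unfolding lie_derivative_form_def using assms
  by (intro C_diff C_sum VF_smooth[OF Z] FA_smooth lists_list_update VF_bracket[OF Z] nth_VF) auto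

lemma LD_update:
  assumes "Ys \<in> lists VF" "length Ys = n" "i < n"
  shows "LD (Ys[i := U]) p = Z p (FA (Ys[i := U])) - (FA (Ys[i := lie_bracket Z U]) p +
    (\<Sum>j\<in>{..<n} - {i}. FA (Ys[j := lie_bracket Z (Ys ! j), i := U]) p))"
proof -
  have "(\<Sum>j<n. FA (Ys[i := U, j := lie_bracket Z (Ys[i := U] ! j)]) p) =
      FA (Ys[i := U, i := lie_bracket Z (Ys[i := U] ! i)]) p +
      (\<Sum>j\<in>{..<n} - {i}. FA (Ys[i := U, j := lie_bracket Z (Ys[i := U] ! j)]) p)"
    using assms(3) by (intro sum.remove) auto
  also have "(\<Sum>j\<in>{..<n} - {i}. FA (Ys[i := U, j := lie_bracket Z (Ys[i := U] ! j)]) p) =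
      (\<Sum>j\<in>{..<n} - {i}. FA (Ys[j := lie_bracket Z (Ys ! j), i := U]) p)"
    by (intro sum.cong) (auto simp: list_update_swap)
  finally show ?thesis using assms by (simp add: lie_derivative_form_def)
qed

lemma LD_add:
  assumes Ys: "Ys \<in> lists VF" "length Ys = n" "i < n" and U: "U \<in> VF" and W: "W \<in> VF"
  shows "LD (Ys[i := \<lambda>p. U p + W p]) p = LD (Ys[i := U]) p + LD (Ys[i := W]) p"
proof -
  note FA_add' = FA_add[OF Ys U W]
  have "Z p (FA (Ys[i := \<lambda>p. U p + W p])) = Z p (\<lambda>q. FA (Ys[i := U]) q + FA (Ys[i := W]) q)"
    using FA_add' by presburger
  also have "\<dots> = Z p (FA (Ys[i := U])) + Z p (FA (Ys[i := W]))"
    by (intro tangent_add[OF VF_tangent[OF Z]] FA_update_smooth Ys U W)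
  finally have 1: "Z p (FA (Ys[i := \<lambda>p. U p + W p])) = Z p (FA (Ys[i := U])) + Z p (FA (Ys[i := W]))" .
  have 2: "FA (Ys[j := lie_bracket Z (Ys ! j), i := \<lambda>p. U p + W p]) p =
      FA (Ys[j := lie_bracket Z (Ys ! j), i := U]) p + FA (Ys[j := lie_bracket Z (Ys ! j), i := W]) p"
    if "j \<in> {..<n} - {i}" for j
    using that Ys by (intro FA_add lists_list_update VF_bracket[OF Z] nth_VF U W) auto
  have 3: "FA (Ys[i := lie_bracket Z (\<lambda>p. U p + W p)]) p =
      FA (Ys[i := lie_bracket Z U]) p + FA (Ys[i := lie_bracket Z W]) p"
    unfolding bracket_add[OF Z U W] by (intro FA_add Ys VF_bracket Z U W)
  show ?thesis
    unfolding LD_update[OF Ys] 1 3 by (simp add: 2 sum.distrib)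
qed

text \<open>Two terms with Z f arise, one from the Leibniz rule for Z(f \<Omega>(..., U, ...)) and
  one from [Z, f U] = Z(f) U + f [Z, U]; they cancel.\<close>

lemma LD_scale:
  assumes Ys: "Ys \<in> lists VF" "length Ys = n" "i < n" and U: "U \<in> VF" and f: "f \<in> C"
  shows "LD (Ys[i := \<lambda>p. f p *\<^sub>R U p]) p = f p * LD (Ys[i := U]) p"
proof -
  note FA_scale' = FA_scale[OF Ys U]
  have "Z p (FA (Ys[i := \<lambda>p. f p *\<^sub>R U p])) = Z p (\<lambda>q. f q * FA (Ys[i := U]) q)"
    using FA_scale' by presburger
  also have "\<dots> = f p * Z p (FA (Ys[i := U])) + FA (Ys[i := U]) p * Z p f"
    by (intro tangent_mult[OF VF_tangent[OF Z] f] FA_update_smooth Ys U)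
  finally have 1: "Z p (FA (Ys[i := \<lambda>p. f p *\<^sub>R U p])) =
      f p * Z p (FA (Ys[i := U])) + FA (Ys[i := U]) p * Z p f" .
  have 2: "FA (Ys[j := lie_bracket Z (Ys ! j), i := \<lambda>p. f p *\<^sub>R U p]) p =
      f p * FA (Ys[j := lie_bracket Z (Ys ! j), i := U]) p"
    if "j \<in> {..<n} - {i}" for j
    using that Ys by (intro FA_scale lists_list_update VF_bracket[OF Z] nth_VF U) auto
  have 3: "FA (Ys[i := lie_bracket Z (\<lambda>p. f p *\<^sub>R U p)]) p =
      Z p f * FA (Ys[i := U]) p + f p * FA (Ys[i := lie_bracket Z U]) p"
    unfolding bracket_scale[OF Z U f]
    by (subst FA_add) (simp_all only: FA_scale VF_scale VF_bracket Z U f Ys VF_smooth)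
  show ?thesis
    unfolding LD_update[OF Ys] 1 3 by (simp add: 2 algebra_simps flip: sum_distrib_left)
qed

lemma LD_sum:
  assumes Ys: "Ys \<in> lists VF" "length Ys = n" "i < n" and U: "\<And>j. j \<in> J \<Longrightarrow> U j \<in> VF"
  shows "LD (Ys[i := \<lambda>p. \<Sum>j\<in>J. U j p]) p = (\<Sum>j\<in>J. LD (Ys[i := U j]) p)"
  using U
proof (induction J rule: infinite_finite_induct)
  case (insert x J)
  have V: "U x \<in> VF" "(\<lambda>p. \<Sum>j\<in>J. U j p) \<in> VF" using insert.prems by (auto intro: VF_sum)
  show ?case
    unfolding sum.insert[OF insert.hyps] LD_add[OF Ys V] using insert.IH insert.prems by simp
qed (use LD_scale[OF Ys VF_zero C_const, of 0] in auto)

text \<open>Multiplying by the square of \<open>w = \<Omega>(E\<^sub>1,\<dots>,E\<^sub>n)\<close> turns Cramer's rule for a frame \<open>E\<close> at \<open>p\<close> into an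
  identity between global vector fields.\<close>

lemma LD_eq_0_at:
  assumes Ys: "Ys \<in> lists VF" "length Ys = n" "i < n" and U: "U \<in> VF" and "U p = 0"
  shows "LD (Ys[i := U]) p = 0"
proof -
  obtain Es where Es: "Es \<in> lists VF" "length Es = n" "FA Es p \<noteq> 0" by (rule frame_at)
  let ?w = "FA Es"
  have w: "?w \<in> C" using FA_smooth Es by blast
  have c: "FA (Es[j := U]) \<in> C" for j
    by (rule FA_update_smooth[OF Es(1,2) U])
  have E: "Es ! j \<in> VF" if "j < n" for j using nth_VF Es that by blast
  have "(?w q * ?w q) *\<^sub>R U q = (\<Sum>j<n. (?w q * FA (Es[j := U]) q) *\<^sub>R (Es ! j) q)" for q
  proof (cases "?w q = 0")
    case False
    have "?w q *\<^sub>R U q = (\<Sum>j<n. FA (Es[j := U]) q *\<^sub>R (Es ! j) q)"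
      by (rule FA_cramer[OF Es(1,2) False U])
    then have "?w q *\<^sub>R ?w q *\<^sub>R U q = ?w q *\<^sub>R (\<Sum>j<n. FA (Es[j := U]) q *\<^sub>R (Es ! j) q)" by simp
    then show ?thesis by (simp add: scaleR_sum_right)
  qed simp
  then have "LD (Ys[i := \<lambda>q. (?w q * ?w q) *\<^sub>R U q]) p =
      LD (Ys[i := \<lambda>q. \<Sum>j<n. (?w q * FA (Es[j := U]) q) *\<^sub>R (Es ! j) q]) p"
    by presburger
  also have "\<dots> = (\<Sum>j<n. LD (Ys[i := \<lambda>q. (?w q * FA (Es[j := U]) q) *\<^sub>R (Es ! j) q]) p)"
    by (intro LD_sum Ys VF_scale C_mult w c E) simp
  also have "\<dots> = (\<Sum>j<n. (?w p * FA (Es[j := U]) p) * LD (Ys[i := Es ! j]) p)"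
    by (intro sum.cong refl LD_scale Ys C_mult w c E) simp
  \<comment> \<open>The coefficients of the expansion vanish at p, because there U fills a slot of
    \<Omega> with 0.\<close>
  also have "\<dots> = 0"
    using \<Omega>.form_zero[OF fields_at[OF Es(1)]] Es(2) by (simp add: FA_update \<open>U p = 0\<close>)
  finally show ?thesis
    using LD_scale[OF Ys U C_mult[OF w w]] Es(3) by simp
qed

text \<open>The entries are exchanged one at a time; each exchange changes the value by the Lie
  derivative with a field vanishing at p in that slot.\<close>

lemma LD_cong_at:
  assumes Y: "Ys \<in> lists VF" "length Ys = n" and W: "Ws \<in> lists VF" "length Ws = n"
    and eq: "\<And>i. i < n \<Longrightarrow> (Ys ! i) p = (Ws ! i) p"
  shows "LD Ys p = LD Ws p"
proof -
  have "LD (take m Ws @ drop m Ys) p = LD Ys p" if "m \<le> n" for m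
    using that
  proof (induction m)
    case (Suc m)
    then have m: "m < n" by simp
    let ?L = "take m Ws @ drop m Ys"
    have L: "?L \<in> lists VF" "length ?L = n"
      using Y W m by (auto dest: in_set_takeD in_set_dropD)
    have V: "Ys ! m \<in> VF" "Ws ! m \<in> VF" using nth_VF Y W m by auto
    let ?d = "\<lambda>p. (- 1) *\<^sub>R (Ys ! m) p"
    have d: "?d \<in> VF" by (intro VF_scale C_const V)
    have "take (Suc m) Ws @ drop (Suc m) Ys = ?L[m := Ws ! m]"
      using m Y W by (simp add: list_update_append take_Suc_conv_app_nth flip: Cons_nth_drop_Suc)
    moreover have "?L = ?L[m := Ys ! m]"
      using m Y W by (simp add: list_update_append flip: Cons_nth_drop_Suc)
    moreover have "LD (?L[m := \<lambda>p. (Ws ! m) p + ?d p]) p = 0"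
      by (rule LD_eq_0_at[OF L m VF_add[OF V(2) d]]) (use eq[OF m] in simp)
    then have "LD (?L[m := Ws ! m]) p = LD (?L[m := Ys ! m]) p"
      unfolding LD_add[OF L m V(2) d] using LD_scale[OF L m V(1) C_const, of "-1"] by simp
    ultimately show ?case using Suc by simp
  qed simp
  from this[of n] show ?thesis using Y W by simp
qed

text \<open>Let slots i and j agree. \<Omega> on the fields is identically 0, and bracketing any
  third slot keeps the repetition. Bracketing slot i and bracketing slot j give values that differ
  by a swap, hence cancel.\<close>

lemma LD_not_distinct:
  assumes Ys: "Ys \<in> lists VF" "length Ys = n" "\<not> distinct Ys" shows "LD Ys p = 0"
proof -
  obtain i j where ij: "i < n" "j < n" "i \<noteq> j" "Ys ! i = Ys ! j"
    using Ys(2,3) by (auto simp: distinct_conv_nth)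
  have "FA Ys q = 0" for q
    unfolding form_apply_def
    by (rule \<Omega>.form_not_distinct[OF fields_at[OF Ys(1)]]) (use Ys in \<open>auto simp: distinct_map\<close>)
  then have 1: "Z p (FA Ys) = 0" using tangent_const[OF VF_tangent[OF Z], of p 0] by (simp add: ext[of "FA Ys" "\<lambda>_. 0"])
  let ?y = "map (\<lambda>Y. Y p) Ys" and ?a = "(Ys ! i) p" and ?b = "lie_bracket Z (Ys ! i) p"
  let ?t = "\<lambda>l. FA (Ys[l := lie_bracket Z (Ys ! l)]) p"
  have yi: "?y[i := ?a] = ?y" and yj: "?y[j := ?a] = ?y"
    using list_update_id[of ?y i] list_update_id[of ?y j] ij Ys(2) by simp_all
  have ab: "?a \<in> T p" "?b \<in> T p"
    using nth_VF[OF Ys(1,2) ij(1)] by (auto intro: VF_tangent VF_bracket[OF Z])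
  have "?t l = 0" if "l \<in> {..<n} - {i, j}" for l
    unfolding form_apply_def
  proof (rule \<Omega>.form_not_distinct[OF fields_at[OF lists_list_update]])
    have "map (\<lambda>Y. Y p) (Ys[l := lie_bracket Z (Ys ! l)]) ! i = map (\<lambda>Y. Y p) (Ys[l := lie_bracket Z (Ys ! l)]) ! j"
      using that ij Ys(2) by simp
    then show "\<not> distinct (map (\<lambda>Y. Y p) (Ys[l := lie_bracket Z (Ys ! l)]))"
      using ij Ys(2) nth_eq_iff_index_eq[of "map (\<lambda>Y. Y p) (Ys[l := lie_bracket Z (Ys ! l)])" i j] by auto
  qed (use Ys that in \<open>auto intro!: VF_bracket[OF Z]\<close>)
  then have "(\<Sum>l<n. ?t l) = (\<Sum>l\<in>{i, j}. ?t l)"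
    using ij by (intro sum.mono_neutral_right) auto
  also have "\<dots> = ?t i + ?t j" using ij(3) by simp
  also have "?t i = \<Omega> p (?y[i := ?b, j := ?a])"
    by (simp add: FA_update list_update_swap[OF ij(3)] yj)
  also have "?t j = \<Omega> p (?y[i := ?a, j := ?b])"
    using yi ij(4) by (simp add: FA_update)
  also have "\<Omega> p (?y[i := ?b, j := ?a]) + \<Omega> p (?y[i := ?a, j := ?b]) = 0"
    using \<Omega>.form_swap[OF fields_at[OF Ys(1)] _ ij(1-3) ab(2,1)] Ys(2) by simp
  finally show ?thesis by (simp add: lie_derivative_form_def 1 Ys(2))
qed

text \<open>Evaluating on extensions of vectors turns L_Z \<Omega> into a form \<eta> on the tangent
  space at p; by \<open>LD_cong_at\<close> the choice of extensions does not matter. Then \<eta> and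
  \<Omega> are two top forms on the same space.\<close>

lemma LD_proportional:
  assumes Es: "Es \<in> lists VF" "length Es = n" "FA Es p \<noteq> 0" and Ys: "Ys \<in> lists VF" "length Ys = n"
  shows "LD Ys p * FA Es p = FA Ys p * LD Es p"
proof -
  define ext where "ext = extension p"
  note ext = extension[of _ p, folded ext_def]
  define \<eta> where "\<eta> vs = LD (map ext vs) p" for vs
  have \<eta>: "\<eta> (map (\<lambda>Y. Y p) Ys) = LD Ys p" if Ys: "Ys \<in> lists VF" "length Ys = n" for Ys
    unfolding \<eta>_def by (rule LD_cong_at) (use Ys ext VF_tangent in auto)
  have "alternating_multilinear (T p) n \<eta>"
    unfolding alternating_multilinear_def
  proof (intro ballI impI conjI allI)
    fix vs assume vs: "vs \<in> lists (T p)" "length vs = n"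
    have E: "map ext vs \<in> lists VF" "length (map ext vs) = n" using vs ext by auto
    show "\<not> distinct vs \<Longrightarrow> \<eta> vs = 0"
      unfolding \<eta>_def using LD_not_distinct[OF E] by (auto simp: distinct_map)
    fix i u w and a b :: real assume i: "i < n" and uw: "u \<in> T p" "w \<in> T p"
    have vm: "map (\<lambda>Y. Y p) (map ext vs) = vs" using vs(1) ext by (simp add: map_idI in_lists_conv_set)
    have upd: "\<eta> (vs[i := U p]) = LD ((map ext vs)[i := U]) p" if "U \<in> VF" for U
      using \<eta>[of "(map ext vs)[i := U]"] lists_list_update[OF E(1) that] E(2) vm
      by (simp add: map_update del: map_map)
    have V: "(\<lambda>p. a *\<^sub>R ext u p) \<in> VF" "(\<lambda>p. b *\<^sub>R ext w p) \<in> VF"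
      by (intro VF_scale C_const ext uw)+
    show "\<eta> (vs[i := a *\<^sub>R u + b *\<^sub>R w]) = a * \<eta> (vs[i := u]) + b * \<eta> (vs[i := w])"
      using upd[OF VF_add[OF V]] upd[OF ext(1)[OF uw(1)]] upd[OF ext(1)[OF uw(2)]] ext(2) uw
      by (simp only: LD_add[OF E i V] LD_scale[OF E i ext(1)[OF uw(1)] C_const] LD_scale[OF E i ext(1)[OF uw(2)] C_const])
  qed
  from \<Omega>.top_forms_proportional[OF this fields_at[OF Es(1)] _ _ fields_at[OF Ys(1)]]
  show ?thesis using \<eta> Es Ys by (simp add: form_apply_def)
qed

text \<open>The quotient g is defined with a frame chosen separately at each point, but by
  proportionality its defining equation holds everywhere for every tuple. Fixing the frame of p
  therefore exhibits g as locally divisible, and the same frame forces uniqueness at p.\<close>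

lemma divergence_works:
  shows "divergence n A \<Omega> Z \<in> C"
    and "Ys \<in> lists VF \<Longrightarrow> length Ys = n \<Longrightarrow> LD Ys p = divergence n A \<Omega> Z p * FA Ys p"
proof -
  let ?P = "\<lambda>g. g \<in> C \<and> (\<forall>Ys\<in>lists VF. length Ys = n \<longrightarrow> LD Ys = g * FA Ys)"
  define Es where "Es p = (SOME Es. Es \<in> lists VF \<and> length Es = n \<and> FA Es p \<noteq> 0)" for p
  have Es: "Es p \<in> lists VF \<and> length (Es p) = n \<and> FA (Es p) p \<noteq> 0" for p
    unfolding Es_def by (rule frame_at[of p]) (rule someI, blast)
  define g where "g p = LD (Es p) p / FA (Es p) p" for p
  have g: "LD Ys p = g p * FA Ys p" if "Ys \<in> lists VF" "length Ys = n" for Ys p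
    using LD_proportional[of "Es p" p Ys] Es[of p] that by (simp add: g_def field_simps)
  have "g \<in> C"
  proof (rule smooth_of_locally_divisible)
    fix p
    have "\<forall>x. FA (Es p) x * g x = LD (Es p) x" using g[of "Es p"] Es[of p] by simp
    then show "\<exists>w\<in>C. \<exists>u\<in>C. w p \<noteq> 0 \<and> (\<forall>x. w x * g x = u x)"
      using Es[of p] FA_smooth[of "Es p"] LD_smooth[of "Es p"] by blast
  qed
  moreover have "LD Ys = g * FA Ys" if "Ys \<in> lists VF" "length Ys = n" for Ys
    using g[OF that] by (simp add: fun_eq_iff)
  ultimately have Pg: "?P g" by blast
  have "g' = g" if "?P g'" for g'
  proof
    fix p
    have "LD (Es p) = g' * FA (Es p)" using that Es[of p] by blast
    then show "g' p = g p" using g[of "Es p" p] Es[of p] by simp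
  qed
  with Pg have "?P (divergence n A \<Omega> Z)" unfolding divergence_def by (rule theI[of ?P])
  then show "divergence n A \<Omega> Z \<in> C"
    and "Ys \<in> lists VF \<Longrightarrow> length Ys = n \<Longrightarrow> LD Ys p = divergence n A \<Omega> Z p * FA Ys p"
    by auto
qed

end

section \<open>The first integral\<close>

text \<open>X(Z(\<Omega>(Y))) and Z(X(\<Omega>(Y))) are expanded by the two Lie derivative
  equations; [X,Z] = \<lambda> X says that they differ by \<lambda> X(\<Omega>(Y)). The terms g
  X(\<Omega>(Y)) cancel and the double sums contribute \<lambda> X(\<Omega>(Y)) - \<Omega>(Y)
  X(\<lambda>), so X(g) = X(\<lambda>) remains.\<close>

lemma divergence_derivative:
  assumes X: "X \<in> VF" and Z: "Z \<in> VF" and lam: "lam \<in> C" and g: "g \<in> C"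
    and inv: "\<And>Ys p. Ys \<in> lists VF \<Longrightarrow> length Ys = n \<Longrightarrow> lie_derivative_form X \<Omega> Ys p = 0"
    and div: "\<And>Ys p. Ys \<in> lists VF \<Longrightarrow> length Ys = n \<Longrightarrow> lie_derivative_form Z \<Omega> Ys p = g p * FA Ys p"
    and br: "lie_bracket X Z = (\<lambda>p. lam p *\<^sub>R X p)"
  shows "X p g = X p lam"
proof -
  obtain Y where Y: "Y \<in> lists VF" "length Y = n" "FA Y p \<noteq> 0" by (rule frame_at)
  let ?x = "lie_bracket X" and ?z = "lie_bracket Z"
  have XFA: "X q (FA Ys) = (\<Sum>i<n. FA (Ys[i := ?x (Ys ! i)]) q)"
    if "Ys \<in> lists VF" "length Ys = n" for Ys q
    using inv[OF that, of q] that(2) by (simp add: lie_derivative_form_def)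
  have ZFA: "Z q (FA Ys) = g q * FA Ys q + (\<Sum>i<n. FA (Ys[i := ?z (Ys ! i)]) q)"
    if "Ys \<in> lists VF" "length Ys = n" for Ys q
    using div[OF that, of q] that(2) by (simp add: lie_derivative_form_def)
  have nY: "Y ! i \<in> VF" if "i < n" for i using nth_VF Y that by blast
  have xY: "Y[i := ?x (Y ! i)] \<in> lists VF" "length (Y[i := ?x (Y ! i)]) = n"
    and zY: "Y[i := ?z (Y ! i)] \<in> lists VF" "length (Y[i := ?z (Y ! i)]) = n" if "i < n" for i
    by (simp_all only: length_list_update Y,
      (intro lists_list_update Y VF_bracket X Z nY that)+)
  \<comment> \<open>M and N are the terms with two brackets, first in slot i and then in slot j. The
    second bracket is taken with the already updated list, so the diagonal entries are iterated
    brackets.\<close>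
  define M where "M i j = FA (Y[i := ?z (Y ! i), j := ?x (Y[i := ?z (Y ! i)] ! j)]) p" for i j
  define N where "N i j = FA (Y[i := ?x (Y ! i), j := ?z (Y[i := ?x (Y ! i)] ! j)]) p" for i j
  note tX = VF_tangent[OF X, of p] and tZ = VF_tangent[OF Z, of p]
  have sC: "(\<lambda>q. \<Sum>i<n. FA (Y[i := ?z (Y ! i)]) q) \<in> C"
    by (intro C_sum FA_smooth zY) auto
  have "X p (\<lambda>q. Z q (FA Y)) = X p (\<lambda>q. g q * FA Y q + (\<Sum>i<n. FA (Y[i := ?z (Y ! i)]) q))"
    using ZFA[OF Y(1,2)] by presburger
  also have "\<dots> = g p * X p (FA Y) + FA Y p * X p g + (\<Sum>i<n. X p (FA (Y[i := ?z (Y ! i)])))"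
    unfolding tangent_add[OF tX C_mult[OF g FA_smooth[OF Y(1,2)]] sC] tangent_mult[OF tX g FA_smooth[OF Y(1,2)]]
    by (subst tangent_sum[OF tX]) (use FA_smooth[OF zY] in auto)
  also have "(\<Sum>i<n. X p (FA (Y[i := ?z (Y ! i)]))) = (\<Sum>i<n. \<Sum>j<n. M i j)"
    by (intro sum.cong refl) (simp add: XFA[OF zY] M_def)
  finally have XZ: "X p (\<lambda>q. Z q (FA Y)) =
      g p * X p (FA Y) + FA Y p * X p g + (\<Sum>i<n. \<Sum>j<n. M i j)" .
  have "Z p (\<lambda>q. X q (FA Y)) = Z p (\<lambda>q. \<Sum>i<n. FA (Y[i := ?x (Y ! i)]) q)"
    using XFA[OF Y(1,2)] by presburger
  also have "\<dots> = (\<Sum>i<n. Z p (FA (Y[i := ?x (Y ! i)])))"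
    by (rule tangent_sum[OF tZ]) (use FA_smooth[OF xY] in auto)
  also have "\<dots> = (\<Sum>i<n. g p * FA (Y[i := ?x (Y ! i)]) p + (\<Sum>j<n. N i j))"
    by (intro sum.cong refl) (simp add: ZFA[OF xY] N_def)
  also have "\<dots> = g p * X p (FA Y) + (\<Sum>i<n. \<Sum>j<n. N i j)"
    by (simp add: sum.distrib XFA[OF Y(1,2)] sum_distrib_left)
  finally have ZX: "Z p (\<lambda>q. X q (FA Y)) = g p * X p (FA Y) + (\<Sum>i<n. \<Sum>j<n. N i j)" .
  \<comment> \<open>The Jacobi identity with the outer bracket evaluated: [[X,Z],U] =
    [\<lambda> X, U] = \<lambda> [X,U] - U(\<lambda>) X.\<close>
  have jacobi: "?x (?z U) p = ?z (?x U) p + (lam p *\<^sub>R ?x U p + (- U p lam) *\<^sub>R X p)" if U: "U \<in> VF" for U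
  proof
    fix f :: "'m \<Rightarrow> real"
    note tU = VF_tangent[OF U, of p]
    have XZ: "X q (\<lambda>r. Z r u) = Z q (\<lambda>r. X r u) + lam q * X q u" for q u
      using fun_cong[OF fun_cong[OF br], of q u] by (simp add: lie_bracket_def scaleR_fun_def)
    have s: "(\<lambda>q. V q u) \<in> C" if "V \<in> VF" for V u by (rule VF_apply_smooth[OF that])
    have VV: "(\<lambda>q. V q (\<lambda>r. W r f)) \<in> C" if "V \<in> VF" for V W by (rule VF_apply_smooth[OF that])
    have "?x (?z U) p f = X p (\<lambda>q. Z q (\<lambda>r. U r f)) - X p (\<lambda>q. U q (\<lambda>r. Z r f))
        - (Z p (\<lambda>q. U q (\<lambda>r. X r f)) - U p (\<lambda>q. Z q (\<lambda>r. X r f)))"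
      by (simp add: lie_bracket_def tangent_diff[OF tX s[OF Z] s[OF U]])
    also have "\<dots> = ?z (?x U) p f + lam p * X p (\<lambda>r. U r f)
        + (U p (\<lambda>q. Z q (\<lambda>r. X r f)) - U p (\<lambda>q. X q (\<lambda>r. Z r f)))"
      by (simp add: lie_bracket_def XZ tangent_diff[OF tZ s[OF X] s[OF U]])
    also have "U p (\<lambda>q. X q (\<lambda>r. Z r f)) = U p (\<lambda>q. Z q (\<lambda>r. X r f)) + (lam p * U p (\<lambda>q. X q f) + X p f * U p lam)"
      unfolding XZ tangent_add[OF tU s[OF Z] C_mult[OF lam s[OF X]]] tangent_mult[OF tU lam s[OF X]] ..
    finally show "?x (?z U) p f = (?z (?x U) p + (lam p *\<^sub>R ?x U p + (- U p lam) *\<^sub>R X p)) f"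
      by (simp add: scaleR_fun_def algebra_simps) (simp add: lie_bracket_def algebra_simps)
  qed
  have diag: "M i i - N i i = lam p * FA (Y[i := ?x (Y ! i)]) p - (Y ! i) p lam * FA (Y[i := X]) p"
    if i: "i < n" for i
  proof -
    have t: "?z (?x (Y ! i)) p \<in> T p" "?x (Y ! i) p \<in> T p" "X p \<in> T p"
      by (intro VF_tangent VF_bracket X Z nY i)+
    have t2: "lam p *\<^sub>R ?x (Y ! i) p + (- (Y ! i) p lam) *\<^sub>R X p \<in> T p"
      by (intro subspace_add[OF subspace_tangent] subspace_scale[OF subspace_tangent] t)
    note y = fields_at[OF Y(1), of p] length_map[of "\<lambda>Y. Y p" Y, unfolded Y(2)]
    have "M i i = N i i + (lam p * FA (Y[i := ?x (Y ! i)]) p + (- (Y ! i) p lam) * FA (Y[i := X]) p)"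
      using i Y(2)
      by (simp only: M_def N_def FA_update nth_list_update_eq list_update_overwrite jacobi[OF nY[OF i]]
          \<Omega>.form_add[OF y i t(1) t2] \<Omega>.form_lin[OF y i t(2,3)])
    then show ?thesis by simp
  qed
  \<comment> \<open>For i \<noteq> j both terms hold [Z,Y_i] in slot i and [X,Y_j] in slot j and
    differ only in the order of the updates; hence the transposed indices in N.\<close>
  have off: "M i j - N j i = (if j = i then M i i - N i i else 0)" for i j
    by (simp add: M_def N_def list_update_swap)
  have "(\<Sum>i<n. \<Sum>j<n. M i j) - (\<Sum>i<n. \<Sum>j<n. N i j) = (\<Sum>i<n. \<Sum>j<n. M i j - N j i)"
    by (subst (2) sum.swap) (simp add: sum_subtractf)
  also have "\<dots> = (\<Sum>i<n. \<Sum>j<n. if j = i then M i i - N i i else 0)"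
    by (intro sum.cong refl off)
  also have "\<dots> = (\<Sum>i<n. M i i - N i i)" by simp
  also have "\<dots> = lam p * X p (FA Y) - (\<Sum>i<n. (Y ! i) p lam * FA (Y[i := X]) p)"
    by (simp add: diag sum_subtractf XFA[OF Y(1,2)] sum_distrib_left)
  \<comment> \<open>Cramer's rule for X in the frame Y is an equation between derivations; applied
    to \<lambda> it yields this sum.\<close>
  also have "(\<Sum>i<n. (Y ! i) p lam * FA (Y[i := X]) p) = FA Y p * X p lam"
  proof -
    have app: "(\<Sum>i\<in>I. c i *\<^sub>R v i) lam = (\<Sum>i\<in>I. c i * v i lam)"
      for I c and v :: "nat \<Rightarrow> 'm tvec"
      by (induction I rule: infinite_finite_induct) (auto simp: scaleR_fun_def)
    have "FA Y p *\<^sub>R X p = (\<Sum>i<n. FA (Y[i := X]) p *\<^sub>R (Y ! i) p)"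
      by (rule FA_cramer[OF Y X])
    from fun_cong[OF this, of lam] show ?thesis
      unfolding app by (simp add: scaleR_fun_def mult.commute)
  qed
  finally have "(\<Sum>i<n. \<Sum>j<n. M i j) - (\<Sum>i<n. \<Sum>j<n. N i j) = lam p * X p (FA Y) - FA Y p * X p lam" .
  moreover have "X p (\<lambda>q. Z q (FA Y)) - Z p (\<lambda>q. X q (FA Y)) = lam p * X p (FA Y)"
    using fun_cong[OF fun_cong[OF br], of p "FA Y"] by (simp add: lie_bracket_def scaleR_fun_def)
  ultimately have "FA Y p * X p g = FA Y p * X p lam"
    unfolding XZ ZX by linarith
  then show ?thesis using Y(3) by simp
qed

end

section \<open>Poisson structures of rank at most two\<close>

text \<open>Monotonicity on the first two places leaves only the choice of \<sigma> 2. The 3-cycle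
  is written as a product of transpositions so that its sign can be computed.\<close>

lemma shuffle_perms_2_1:
  "shuffle_perms 2 1 = {id, Transposition.transpose 1 2, Transposition.transpose 0 1 \<circ> Transposition.transpose 1 2}" (is "_ = ?R")
proof
  have three: "{..<2 + 1} = {0, 1, 2::nat}" and two: "{..<2} = {0, 1::nat}"
    and last: "{2..<2 + 1} = {2::nat}"
    by auto
  show "shuffle_perms 2 1 \<subseteq> ?R"
  proof
    fix \<sigma> :: "nat \<Rightarrow> nat"
    assume "\<sigma> \<in> shuffle_perms 2 1"
    then have *: "\<sigma> permutes {..<2 + 1}" "strict_mono_on {..<2} \<sigma>"
      unfolding shuffle_perms_def by blast+
    have perm: "\<sigma> permutes {0, 1, 2}" using *(1) unfolding three .
    have mono: "\<sigma> 0 < \<sigma> 1" by (rule strict_mono_onD[OF *(2)]) simp_all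
    have inj: "\<sigma> 0 \<noteq> \<sigma> 2" "\<sigma> 1 \<noteq> \<sigma> 2" using permutes_inj[OF perm] by (simp_all add: inj_eq)
    have mem: "\<sigma> 0 \<in> {0, 1, 2}" "\<sigma> 1 \<in> {0, 1, 2}" "\<sigma> 2 \<in> {0, 1, 2}"
      by (simp_all only: permutes_in_image[OF perm]) simp_all
    have fix3: "\<sigma> x = x" if "x \<notin> {0, 1, 2}" for x using permutes_not_in[OF perm that] .
    consider "\<sigma> 0 = 0" "\<sigma> 1 = 1" "\<sigma> 2 = 2" | "\<sigma> 0 = 0" "\<sigma> 1 = 2" "\<sigma> 2 = 1"
      | "\<sigma> 0 = 1" "\<sigma> 1 = 2" "\<sigma> 2 = 0"
      using mem mono inj by auto
    then show "\<sigma> \<in> ?R"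
    proof cases
      case 1
      then have "\<sigma> x = id x" for x using fix3[of x] by (cases "x \<in> {0, 1, 2}") auto
      then have "\<sigma> = id" by blast
      then show ?thesis by simp
    next
      case 2
      then have "\<sigma> x = Transposition.transpose 1 2 x" for x
        using fix3[of x] by (cases "x \<in> {0, 1, 2}") (auto simp: Transposition.transpose_def)
      then have "\<sigma> = Transposition.transpose 1 2" by blast
      then show ?thesis by simp
    next
      case 3
      then have "\<sigma> x = (Transposition.transpose 0 1 \<circ> Transposition.transpose 1 2) x" for x
        using fix3[of x] by (cases "x \<in> {0, 1, 2}") (auto simp: Transposition.transpose_def)
      then have "\<sigma> = Transposition.transpose 0 1 \<circ> Transposition.transpose 1 2" by blast
      then show ?thesis by simp
    qed
  qed
  have "Transposition.transpose 1 2 permutes {0, 1, 2::nat}" "Transposition.transpose 0 1 permutes {0, 1, 2::nat}"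
    by (auto intro: permutes_swap_id)
  then show "?R \<subseteq> shuffle_perms 2 1"
    unfolding shuffle_perms_def mem_Collect_eq three two last
    by (auto simp: strict_mono_on_def Transposition.transpose_def intro: permutes_compose permutes_id)
qed

lemma sum_shuffle_perms_2_1:
  "(\<Sum>\<sigma>\<in>shuffle_perms 2 1. of_int (sign \<sigma>) * (F (\<sigma> 0) (\<sigma> 1) (\<sigma> 2) :: real)) =
    F 0 1 2 - F 0 2 1 + F 1 2 0"
proof -
  let ?t = "Transposition.transpose 1 2 :: nat \<Rightarrow> nat" and ?c = "Transposition.transpose 0 1 \<circ> Transposition.transpose 1 2 :: nat \<Rightarrow> nat"
  have v: "?t 0 = 0" "?t 1 = 2" "?t 2 = 1" "?c 0 = 1" "?c 1 = 2" "?c 2 = 0"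
    by (simp_all add: Transposition.transpose_def)
  have "id \<noteq> ?t" "id \<noteq> ?c" "?t \<noteq> ?c"
    using v by (metis id_apply zero_neq_one)+
  moreover have "sign ?t = -1" by (simp add: sign_swap_id)
  moreover have "sign ?c = 1"
    by (subst sign_compose) (simp_all add: sign_swap_id permutation_swap_id)
  ultimately show ?thesis
    unfolding shuffle_perms_2_1 using v by (simp add: sign_id del: comp_apply)
qed

context manifold begin

lemma differential_cotangent: "differential A f p \<in> cotangent_space A p"
  unfolding cotangent_space_def differential_def
  by (simp add: subspace_add[OF subspace_tangent] subspace_scale[OF subspace_tangent])
    (simp add: scaleR_fun_def)

lemma cotangent_combination:
  "\<beta> \<in> cotangent_space A p \<Longrightarrow> v \<in> T p \<Longrightarrow> w \<in> T p \<Longrightarrow> \<beta> (a *\<^sub>R v + b *\<^sub>R w) = a * \<beta> v + b * \<beta> w"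
  by (simp add: cotangent_space_def subspace_scale[OF subspace_tangent])

text \<open>Differentials separate tangent vectors, so reflexivity of the tangent space is not needed to
  identify \<^const>\<open>sharp\<close>.\<close>

lemma sharp_eqI:
  assumes v: "v \<in> T p" and eq: "\<And>\<beta>. \<beta> \<in> cotangent_space A p \<Longrightarrow> \<beta> v = \<pi> p [\<alpha>, \<beta>]"
  shows "sharp A \<pi> p \<alpha> = v"
  unfolding sharp_def
proof (rule the_equality)
  show "v \<in> T p \<and> (\<forall>\<beta>\<in>cotangent_space A p. \<beta> v = \<pi> p [\<alpha>, \<beta>])" using v eq by blast
  fix w assume w: "w \<in> T p \<and> (\<forall>\<beta>\<in>cotangent_space A p. \<beta> w = \<pi> p [\<alpha>, \<beta>])"
  show "w = v"
  proof
    fix f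
    have "differential A f p w = differential A f p v"
      using w eq differential_cotangent[of f p] by simp
    then show "w f = v f" using w v by (simp add: differential_def)
  qed
qed

end

section \<open>The bivector field Z \<and> X divided by k\<close>

text \<open>k stands for L_Z h; its link with h is made in \<open>hamiltonian_\<pi>\<close>.\<close>

locale bivector_rank_two = manifold n A
  for n :: nat and A :: "('m::{t2_space,second_countable_topology}, 'e::euclidean_space) chart set" +
  fixes X Z :: "'m vfield" and lam k :: "'m \<Rightarrow> real" and \<pi> :: "'m mvfield"
  assumes X: "X \<in> VF" and Z: "Z \<in> VF" and lam: "lam \<in> C" and k: "k \<in> C"
    and br: "lie_bracket X Z = (\<lambda>p. lam p *\<^sub>R X p)"
    and k_nonzero: "\<And>p. p \<in> vf_support X \<Longrightarrow> k p \<noteq> 0"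
    and \<pi>_def: "\<pi> = (\<lambda>p. if p \<in> vf_support X then (1 / k p) *\<^sub>R wedge (Z p) (X p) else 0)"
begin

lemma X_zero: "p \<notin> vf_support X \<Longrightarrow> X p = 0"
  using closure_subset[of "{p. X p \<noteq> 0}"] by (auto simp: vf_support_def)

abbreviation "B f g \<equiv> mv_apply A \<pi> [f, g]"

lemma B_off_support: "p \<notin> vf_support X \<Longrightarrow> B f g p = 0"
  by (simp add: mv_apply_def \<pi>_def)

lemma k_B: "k p * B f g p = Z p f * X p g - X p f * Z p g"
proof (cases "p \<in> vf_support X")
  case True
  then show ?thesis
    using k_nonzero[OF True] VF_tangent[OF X] VF_tangent[OF Z]
    by (simp add: mv_apply_def \<pi>_def wedge_def scaleR_fun_def differential_def)
qed (simp add: B_off_support X_zero)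

text \<open>Points on the boundary of {X \<noteq> 0} belong to the support, where k itself is a
  valid divisor. The remaining points form an open set, so a bump living there leaves the product
  with the bracket identically 0.\<close>

lemma B_smooth: assumes f: "f \<in> C" and g: "g \<in> C" shows "B f g \<in> C"
proof (rule smooth_of_locally_divisible)
  fix p
  show "\<exists>w\<in>C. \<exists>u\<in>C. w p \<noteq> 0 \<and> (\<forall>x. w x * B f g x = u x)"
  proof (cases "p \<in> vf_support X")
    case True
    have "(\<lambda>x. Z x f * X x g - X x f * Z x g) \<in> C"
      by (intro C_diff C_mult VF_apply_smooth[OF X] VF_apply_smooth[OF Z])
    then show ?thesis by (intro bexI[OF _ k] bexI) (simp_all add: k_nonzero[OF True] k_B)
  next
    case False
    have "open (- vf_support X)" unfolding vf_support_def by (intro open_Compl closed_closure)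
    then obtain b where b: "b \<in> C" "b p \<noteq> 0" "\<And>x. x \<notin> - vf_support X \<Longrightarrow> b x = 0"
      using bump_function[of "- vf_support X" p] False by blast
    then have "\<forall>x. b x * B f g x = 0" using B_off_support by auto
    then show ?thesis using b(2) by (intro bexI[OF _ b(1)] bexI[OF _ C_const[of 0]]) simp
  qed
qed

text \<open>Multiplying by k twice clears both denominators. The derivative of an inner bracket is
  obtained by differentiating the equation \<open>k_B\<close>, which costs a term with the
  derivative of k.\<close>

lemma jacobi:
  assumes f: "f\<^sub>0 \<in> C" "f\<^sub>1 \<in> C" "f\<^sub>2 \<in> C"
  shows "B (B f\<^sub>0 f\<^sub>1) f\<^sub>2 p - B (B f\<^sub>0 f\<^sub>2) f\<^sub>1 p + B (B f\<^sub>1 f\<^sub>2) f\<^sub>0 p = 0"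
proof (cases "p \<in> vf_support X")
  case True
  note nz = k_nonzero[OF True] and tX = VF_tangent[OF X, of p] and tZ = VF_tangent[OF Z, of p]
  have s: "(\<lambda>q. X q f) \<in> C" "(\<lambda>q. Z q f) \<in> C" for f
    using VF_apply_smooth[OF X] VF_apply_smooth[OF Z] by auto
  have XZ: "X p (\<lambda>q. Z q f) = Z p (\<lambda>q. X q f) + lam p * X p f" for f
    using fun_cong[OF fun_cong[OF br], of p f] by (simp add: lie_bracket_def scaleR_fun_def)
  have D: "k p * v (B f g) = v (\<lambda>q. Z q f) * X p g + Z p f * v (\<lambda>q. X q g)
      - v (\<lambda>q. X q f) * Z p g - X p f * v (\<lambda>q. Z q g) - B f g p * v k"
    if v: "v \<in> T p" and fg: "f \<in> C" "g \<in> C" for v f g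
  proof -
    have "v (\<lambda>q. k q * B f g q) = v (\<lambda>q. Z q f * X q g - X q f * Z q g)"
      using k_B by presburger
    then show ?thesis
      unfolding tangent_diff[OF v C_mult[OF s(2) s(1)] C_mult[OF s(1) s(2)]] tangent_mult[OF v s(2) s(1)]
        tangent_mult[OF v s(1) s(2)] tangent_mult[OF v k B_smooth[OF fg]]
      by (simp add: algebra_simps)
  qed
  \<comment> \<open>k times this sum is the 3 by 3 determinant with rows Z, X and v evaluated on the
    three functions, so it vanishes when v is X p or Z p.\<close>
  let ?c = "\<lambda>v :: 'm tvec. B f\<^sub>0 f\<^sub>1 p * v f\<^sub>2 - B f\<^sub>0 f\<^sub>2 p * v f\<^sub>1 + B f\<^sub>1 f\<^sub>2 p * v f\<^sub>0"
  have kc: "k p * ?c v = (Z p f\<^sub>0 * X p f\<^sub>1 - X p f\<^sub>0 * Z p f\<^sub>1) * v f\<^sub>2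
      - (Z p f\<^sub>0 * X p f\<^sub>2 - X p f\<^sub>0 * Z p f\<^sub>2) * v f\<^sub>1 + (Z p f\<^sub>1 * X p f\<^sub>2 - X p f\<^sub>1 * Z p f\<^sub>2) * v f\<^sub>0" for v
    unfolding k_B[symmetric] by (simp add: algebra_simps)
  have "k p * ?c (X p) = 0" "k p * ?c (Z p) = 0"
    unfolding kc by (simp_all add: algebra_simps)
  then have c: "?c (X p) = 0" "?c (Z p) = 0" using nz by simp_all
  have "k p * (k p * (B (B f\<^sub>0 f\<^sub>1) f\<^sub>2 p - B (B f\<^sub>0 f\<^sub>2) f\<^sub>1 p + B (B f\<^sub>1 f\<^sub>2) f\<^sub>0 p)) =
      (k p * Z p (B f\<^sub>0 f\<^sub>1)) * X p f\<^sub>2 - (k p * X p (B f\<^sub>0 f\<^sub>1)) * Z p f\<^sub>2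
      - ((k p * Z p (B f\<^sub>0 f\<^sub>2)) * X p f\<^sub>1 - (k p * X p (B f\<^sub>0 f\<^sub>2)) * Z p f\<^sub>1)
      + ((k p * Z p (B f\<^sub>1 f\<^sub>2)) * X p f\<^sub>0 - (k p * X p (B f\<^sub>1 f\<^sub>2)) * Z p f\<^sub>0)"
    by (simp only: distrib_left right_diff_distrib k_B)
  \<comment> \<open>All second derivatives cancel, and the \<lambda> terms cancel inside each
    X-derivative. Only the derivatives of k survive, multiplied by \<open>?c\<close>.\<close>
  also have "\<dots> = X p k * ?c (Z p) - Z p k * ?c (X p)"
    by (simp only: D[OF tX] D[OF tZ] f XZ) (simp add: algebra_simps)
  finally show ?thesis using c nz by simp
qed (simp add: B_off_support)

lemma multivector_field_\<pi>: "multivector_field A 2 \<pi>"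
  unfolding multivector_field_def
proof (intro conjI allI ballI impI)
  fix fs assume fs: "fs \<in> lists C" "length fs = 2"
  then obtain f g where "fs = [f, g]" by (auto simp: length_Suc_conv numeral_2_eq_2)
  then show "mv_apply A \<pi> fs \<in> C" using B_smooth fs by simp
next
  fix p
  show "alternating_multilinear (cotangent_space A p) 2 (\<pi> p)"
    unfolding alternating_multilinear_def
  proof (intro ballI impI conjI allI)
    fix vs u w and i :: nat and a b :: real
    assume vs: "vs \<in> lists (cotangent_space A p)" "length vs = 2"
    then obtain \<alpha> \<beta> where ab: "vs = [\<alpha>, \<beta>]" by (auto simp: length_Suc_conv numeral_2_eq_2)
    show "\<not> distinct vs \<Longrightarrow> \<pi> p vs = 0"
      by (auto simp: ab \<pi>_def wedge_def scaleR_fun_def)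
    assume "i < 2"
    then have "i = 0 \<or> i = 1" by auto
    then show "\<pi> p (vs[i := a *\<^sub>R u + b *\<^sub>R w]) = a * \<pi> p (vs[i := u]) + b * \<pi> p (vs[i := w])"
      by (auto simp: ab \<pi>_def wedge_def scaleR_fun_def divide_simps) (simp_all add: algebra_simps)
  qed
qed

lemma poisson_structure_\<pi>: "poisson_structure A \<pi>"
  unfolding poisson_structure_def
proof (intro conjI ballI impI multivector_field_\<pi>)
  fix fs assume fs: "fs \<in> lists C" "length fs = 3"
  then obtain f\<^sub>0 f\<^sub>1 f\<^sub>2 where eq: "fs = [f\<^sub>0, f\<^sub>1, f\<^sub>2]" by (auto simp: length_Suc_conv numeral_3_eq_3)
  \<comment> \<open>For two bivectors the sign in the Schouten bracket is -1, so [\<pi>,\<pi>] is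
    twice this sum, whose three shuffle terms form the Jacobi expression.\<close>
  have "insertion_sum A 2 2 \<pi> \<pi> fs p = 0" for p
  proof -
    have "insertion_sum A 2 2 \<pi> \<pi> fs p = (\<Sum>\<sigma>\<in>shuffle_perms 2 1. of_int (sign \<sigma>) *
        B (B (fs ! \<sigma> 0) (fs ! \<sigma> 1)) (fs ! \<sigma> 2) p)"
      by (simp add: insertion_sum_def upt_rec)
    also have "\<dots> = B (B f\<^sub>0 f\<^sub>1) f\<^sub>2 p - B (B f\<^sub>0 f\<^sub>2) f\<^sub>1 p + B (B f\<^sub>1 f\<^sub>2) f\<^sub>0 p"
      unfolding sum_shuffle_perms_2_1[of "\<lambda>i j l. B (B (fs ! i) (fs ! j)) (fs ! l) p"] by (simp add: eq)
    also have "\<dots> = 0" by (rule jacobi) (use fs eq in auto)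
    finally show ?thesis .
  qed
  then show "schouten_bracket A 2 2 \<pi> \<pi> fs = 0"
    by (simp add: schouten_bracket_def fun_eq_iff)
qed

text \<open>Contracting Z \<and> X with \<alpha> gives \<alpha>(Z) X - \<alpha>(X) Z. This formula
  confines the image to the span of two vectors, which yields the rank bound.\<close>

lemma sharp_\<pi>:
  "sharp A \<pi> p \<alpha> =
    (if p \<in> vf_support X then (\<alpha> (Z p) / k p) *\<^sub>R X p + (- \<alpha> (X p) / k p) *\<^sub>R Z p else 0)"
proof (rule sharp_eqI)
  note t = VF_tangent[OF X, of p] VF_tangent[OF Z, of p]
  show "(if p \<in> vf_support X then (\<alpha> (Z p) / k p) *\<^sub>R X p + (- \<alpha> (X p) / k p) *\<^sub>R Z p else 0) \<in> T p"
    using t by (auto intro!: subspace_add[OF subspace_tangent] subspace_scale[OF subspace_tangent]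
        subspace_0[OF subspace_tangent] simp del: scaleR_minus_left)
  fix \<beta> assume \<beta>: "\<beta> \<in> cotangent_space A p"
  have "\<beta> 0 = 0" using cotangent_combination[OF \<beta> t, of 0 0] by simp
  then show "\<beta> (if p \<in> vf_support X then (\<alpha> (Z p) / k p) *\<^sub>R X p + (- \<alpha> (X p) / k p) *\<^sub>R Z p else 0) =
      \<pi> p [\<alpha>, \<beta>]"
    using k_nonzero[of p] cotangent_combination[OF \<beta> t, of "\<alpha> (Z p) / k p" "- \<alpha> (X p) / k p"]
    by (auto simp: \<pi>_def wedge_def scaleR_fun_def field_simps)
qed

lemma bivector_rank_\<pi>: "bivector_rank A \<pi> p \<le> 2"
proof -
  have "sharp A \<pi> p ` cotangent_space A p \<subseteq> span {X p, Z p}"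
    by (auto simp: sharp_\<pi> span_zero simp del: scaleR_minus_left
        intro!: span_add span_scale intro: span_base)
  then have "dim (sharp A \<pi> p ` cotangent_space A p) \<le> card {X p, Z p}"
    by (rule dim_le_card) simp
  also have "\<dots> \<le> 2" by (simp add: card_insert_if)
  finally show ?thesis by (simp add: bivector_rank_def)
qed

lemma hamiltonian_\<pi>:
  assumes h: "h \<in> C" and Xh: "\<And>p. X p h = 0" and Zh: "\<And>p. Z p h = k p"
  shows "hamiltonian A \<pi> X"
  unfolding hamiltonian_def
proof (intro bexI[OF _ h] allI)
  show "X p = sharp A \<pi> p (differential A h p)" for p
    using VF_tangent[OF X, of p] VF_tangent[OF Z, of p] k_nonzero[of p] X_zero[of p]
    by (simp add: sharp_\<pi> differential_def Xh Zh)
qed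

end

theorem theorem4p7:
  fixes A :: "('m::{t2_space,second_countable_topology}, 'e::euclidean_space) chart set"
    and n :: nat
    and X Z :: "'m vfield"
    and \<Omega> :: "'m form"
    and lam h :: "'m \<Rightarrow> real"
    and \<pi> :: "'m mvfield"
  assumes "smooth_manifold n A"
    and "X \<in> vector_fields A"
    and "volume_form n A \<Omega>"
    and "invariant_form n A X \<Omega>"
    and "Z \<in> vector_fields A"
    and "lam \<in> smooth_functions A"
    and "lie_bracket X Z = (\<lambda>p. lam p *\<^sub>R X p)"
    and h_def: "h = divergence n A \<Omega> Z - lam"
    and pi_def: "\<pi> = (\<lambda>p. if p \<in> vf_support X
                           then (1 / lie_derivative_fun Z h p) *\<^sub>R wedge (Z p) (X p)
                           else 0)"
  shows "first_integral A X h \<and>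
    ((\<forall>p\<in>vf_support X. lie_derivative_fun Z h p \<noteq> 0) \<longrightarrow>
       poisson_structure A \<pi> \<and> (\<forall>p. bivector_rank A \<pi> p \<le> 2) \<and> hamiltonian A \<pi> X)"
proof -
  interpret volume_manifold n A \<Omega> using assms(1,3) by unfold_locales
  note X = assms(2) and Z = assms(5) and lam = assms(6) and br = assms(7)
  let ?g = "divergence n A \<Omega> Z"
  note g = divergence_works[OF Z]
  have h_eq: "h = (\<lambda>q. ?g q - lam q)" by (simp add: h_def fun_eq_iff)
  have hC: "h \<in> C" unfolding h_eq by (intro C_diff g(1) lam)
  have inv: "lie_derivative_form X \<Omega> Ys p = 0" if "Ys \<in> lists VF" "length Ys = n" for Ys p
    using assms(4) that by (simp add: invariant_form_def)
  have "X p ?g = X p lam" for p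
    by (rule divergence_derivative[OF X Z lam g(1) _ _ br]) (fact inv g(2))+
  then have Xh: "X p h = 0" for p
    unfolding h_eq tangent_diff[OF VF_tangent[OF X] g(1) lam] by simp
  have "first_integral A X h"
    using hC Xh by (simp add: first_integral_def differential_def)
  moreover have "poisson_structure A \<pi> \<and> (\<forall>p. bivector_rank A \<pi> p \<le> 2) \<and> hamiltonian A \<pi> X"
    if nz: "\<forall>p\<in>vf_support X. lie_derivative_fun Z h p \<noteq> 0"
  proof -
    \<comment> \<open>With k taken to be L_Z h, the equation Z h = k required for the Hamiltonian
      property holds by definition.\<close>
    interpret bivector_rank_two n A X Z lam "lie_derivative_fun Z h" \<pi>
      using X Z lam br nz pi_def VF_smooth[OF Z hC]
      by unfold_locales (auto simp: lie_derivative_fun_def)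
    show ?thesis
      using poisson_structure_\<pi> bivector_rank_\<pi> hamiltonian_\<pi>[OF hC Xh] by (simp add: lie_derivative_fun_def)
  qed
  ultimately show ?thesis by blast
qed

end
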